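(* Let $N>2$ be an integer, and let $A(z)=V(\mathbf{1}-Q+zQ)$, $z\in\mathbb{T}$, where $V\in\mathrm{U}(N)$ and $Q$ is an orthogonal projection in $\mathcal{B}(\mathbb{C}^N)$ (i.e. $A$ is a polynomial loop of genus $g=2$). Let $T^{(A)}$ be the associated representation of the Cuntz algebra $\mathcal{O}_N$ on $L^2(\mathbb{T})$. Then $T^{(A)}$ is reducible if and only if at least one of the following two conditions holds: (a) $Q_{0,0}=0$; (b) $Q_{N-1,N-1}=0$ and $Q_{N-2,N-2}=1$. Thus $T^{(A)}$ is irreducible for generic loops $A$, i.e. for all such $A$ for which neither (a) nor (b) holds.
   Context: $\mathbb{T}=\{z\in\mathbb{C}:|z|=1\}$ with normalized Haar measure; $\mathrm{U}(N)$ is the group of unitary $N\times N$ matrices; matrix indices run over $0,1,\dots,N-1$. For a map $A=(A_{i,j})_{i,j=0}^{N-1}\colon\mathbb{T}\to\mathrm{U}(N)$ with polynomial entries, put $m_i^{(A)}(z)=\sum_{j=0}^{N-1}z^jA_{i,j}(z^N)$ and define isometries on $L^2(\mathbb{T})$ by $(T_i^{(A)}\xi)(z)=m_i^{(A)}(z)\,\xi(z^N)$, $0\le i<N$. They satisfy the Cuntz relations $T_i^{(A)*}T_j^{(A)}=\delta_{i,j}\mathbf{1}$, $\sum_{i=0}^{N-1}T_i^{(A)}T_i^{(A)*}=\mathbf{1}$, and hence define a representation $T^{(A)}$ ($s_i\mapsto T_i^{(A)}$) of the Cuntz algebra $\mathcal{O}_N$, the universal $C^*$-algebra generated by $s_0,\dots,s_{N-1}$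 satisfying these relations. Irreducible means that no closed subspace other than $\{0\}$ and $L^2(\mathbb{T})$ is invariant under all $T_i^{(A)}$ and $T_i^{(A)*}$; reducible means not irreducible. *)

theory Defs
  imports
    "HOL-Analysis.Analysis"
    "Jordan_Normal_Form.Schur_Decomposition"
begin

section \<open>Unitary matrices and orthogonal projections\<close>

definition unitary_group :: "nat \<Rightarrow> complex mat set" where
  "unitary_group N =
    {U \<in> carrier_mat N N. mat_adjoint U * U = 1\<^sub>m N \<and> U * mat_adjoint U = 1\<^sub>m N}"

definition orthogonal_projections :: "nat \<Rightarrow> complex mat set" where
  "orthogonal_projections N = {Q \<in> carrier_mat N N. Q * Q = Q \<and> mat_adjoint Q = Q}"

section \<open>The Hilbert space of square-integrable functions on the circle\<close>

text \<open>
  Normalized Haar measure on the unit circle: the image of the normalized Lebesgue measure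
  on \<open>[0, 2\<pi>)\<close> under \<open>t \<mapsto> exp (i t)\<close>. Its space is the circle itself, so
  the values of a function off the circle are irrelevant below.
\<close>

definition circle_measure :: "complex measure" where
  "circle_measure =
    distr (uniform_measure lborel {0..<2 * pi}) (restrict_space borel (sphere 0 1)) cis"

lemma prob_space_circle_measure: "emeasure circle_measure (space circle_measure) = 1"
proof -
  have m: "cis \<in> uniform_measure lborel {0..<2 * pi} \<rightarrow>\<^sub>M restrict_space borel (sphere 0 1)"
    by (intro measurable_restrict_space2)
       (auto simp: measurable_cong_sets[OF sets_uniform_measure refl]
             intro!: borel_measurable_continuous_onI continuous_intros)
  have "emeasure circle_measure (space circle_measure)
      = emeasure (uniform_measure lborel {0..<2 * pi}) (cis -` sphere 0 1 \<inter> UNIV)"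
    unfolding circle_measure_def by (subst emeasure_distr[OF m]) (auto simp: space_restrict_space sets_restrict_space_iff)
  also have "cis -` sphere 0 1 \<inter> UNIV = (UNIV :: real set)"
    by auto
  also have "emeasure (uniform_measure lborel {0..<2 * pi}) UNIV = 1"
    by (subst emeasure_uniform_measure) (auto simp: ennreal_divide_self)
  finally show ?thesis .
qed

text \<open>
  Elements of the Hilbert space are represented by square-integrable functions, two functions
  that agree almost everywhere representing the same element. Closed subspaces, defined via
  the \<open>L\<^sup>2\<close>-seminorm, are automatically saturated under this identification
  (lemma \<open>closed_subspace_AE_cong\<close>), so they correspond exactly to the closed subspaces
  of the quotient.
\<close>

definition L2 :: "(complex \<Rightarrow> complex) set" where
  "L2 = {f \<in> borel_measurable circle_measure. integrable circle_measure (\<lambda>z. (cmod (f z))\<^sup>2)}"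

definition L2_inner :: "(complex \<Rightarrow> complex) \<Rightarrow> (complex \<Rightarrow> complex) \<Rightarrow> complex" where
  "L2_inner f g = (LINT z|circle_measure. cnj (f z) * g z)"

definition L2_norm :: "(complex \<Rightarrow> complex) \<Rightarrow> real" where
  "L2_norm f = sqrt (LINT z|circle_measure. (cmod (f z))\<^sup>2)"

definition L2_null :: "(complex \<Rightarrow> complex) set" where
  "L2_null = {f \<in> L2. AE z in circle_measure. f z = 0}"

definition closed_subspace :: "(complex \<Rightarrow> complex) set \<Rightarrow> bool" where
  "closed_subspace M \<longleftrightarrow>
     M \<subseteq> L2 \<and> (\<lambda>z. 0) \<in> M \<and>
     (\<forall>f\<in>M. \<forall>g\<in>M. (\<lambda>z. f z + g z) \<in> M) \<and>
     (\<forall>c. \<forall>f\<in>M. (\<lambda>z. c * f z) \<in> M) \<and>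
     (\<forall>F g. (\<forall>n::nat. F n \<in> M) \<longrightarrow> g \<in> L2 \<longrightarrow>
        (\<lambda>n. L2_norm (\<lambda>z. F n z - g z)) \<longlonglongrightarrow> 0 \<longrightarrow> g \<in> M)"

lemma closed_subspace_AE_cong:
  assumes M: "closed_subspace M" and f: "f \<in> M" and g: "g \<in> L2"
    and eq: "AE z in circle_measure. f z = g z"
  shows "g \<in> M"
proof -
  have "f \<in> L2"
    using M f unfolding closed_subspace_def by (elim conjE) (rule subsetD)
  then have [measurable]: "f \<in> borel_measurable circle_measure" "g \<in> borel_measurable circle_measure"
    using g by (auto simp: L2_def)
  have "(LINT z|circle_measure. (cmod (f z - g z))\<^sup>2) = (LINT z|circle_measure. 0)"
    by (rule integral_cong_AE) (use eq in auto)
  then have "(\<lambda>n::nat. L2_norm (\<lambda>z. f z - g z)) \<longlonglongrightarrow> 0"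
    by (simp add: L2_norm_def)
  moreover have "\<forall>F h. (\<forall>n::nat. F n \<in> M) \<longrightarrow> h \<in> L2 \<longrightarrow>
      (\<lambda>n. L2_norm (\<lambda>z. F n z - h z)) \<longlonglongrightarrow> 0 \<longrightarrow> h \<in> M"
    using M unfolding closed_subspace_def by (elim conjE)
  from this[rule_format, of "\<lambda>_. f" g] f g calculation show ?thesis
    by simp
qed

text \<open>
  The Hilbert space adjoint, determined up to equality almost everywhere of its values
  (compare \<^const>\<open>adjoint\<close> for Euclidean spaces).
\<close>

definition L2_adjoint ::
    "((complex \<Rightarrow> complex) \<Rightarrow> complex \<Rightarrow> complex) \<Rightarrow> (complex \<Rightarrow> complex) \<Rightarrow> complex \<Rightarrow> complex" where
  "L2_adjoint T = (SOME S. \<forall>\<eta>\<in>L2. S \<eta> \<in> L2 \<and> (\<forall>\<xi>\<in>L2. L2_inner (T \<xi>) \<eta> = L2_inner \<xi> (S \<eta>)))"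

section \<open>Representations of the Cuntz algebra\<close>

text \<open>
  A representation of the Cuntz algebra is given by the family \<open>S 0, \<dots>, S (N - 1)\<close> of the
  images of the canonical generators.
\<close>

definition irreducible_rep ::
    "nat \<Rightarrow> (nat \<Rightarrow> (complex \<Rightarrow> complex) \<Rightarrow> complex \<Rightarrow> complex) \<Rightarrow> bool" where
  "irreducible_rep N S \<longleftrightarrow>
     (\<forall>M. closed_subspace M \<and> (\<forall>i<N. \<forall>\<xi>\<in>M. S i \<xi> \<in> M \<and> L2_adjoint (S i) \<xi> \<in> M)
        \<longrightarrow> M = L2_null \<or> M = L2)"

definition reducible_rep ::
    "nat \<Rightarrow> (nat \<Rightarrow> (complex \<Rightarrow> complex) \<Rightarrow> complex \<Rightarrow> complex) \<Rightarrow> bool" where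
  "reducible_rep N S \<longleftrightarrow> \<not> irreducible_rep N S"

definition loop_filter :: "nat \<Rightarrow> (complex \<Rightarrow> complex mat) \<Rightarrow> nat \<Rightarrow> complex \<Rightarrow> complex" where
  "loop_filter N A i z = (\<Sum>j<N. z ^ j * (A (z ^ N) $$ (i, j)))"

definition loop_rep ::
    "nat \<Rightarrow> (complex \<Rightarrow> complex mat) \<Rightarrow> nat \<Rightarrow> (complex \<Rightarrow> complex) \<Rightarrow> complex \<Rightarrow> complex" where
  "loop_rep N A i \<xi> = (\<lambda>z. loop_filter N A i z * \<xi> (z ^ N))"

end

theory Submission
  imports Defs
begin

text \<open>
  Let \<open>P\<close> be the projection onto a reducing subspace and \<open>X k l\<close> the matrix of \<open>P\<close> in the Fourier basis.
  Since \<open>P\<close> commutes with the representation and \<open>Q\<close> is a projection, the cross terms and \<open>V\<close> cancel in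
  \<open>X k l = (\<Sum>i<N. \<langle>P T\<^sub>i\<^sup>* e\<^sub>k, T\<^sub>i\<^sup>* e\<^sub>l\<rangle>)\<close>, which for \<open>k = j + N m\<close> and \<open>l = j' + N m'\<close> becomes
  \<open>X k l = (1 - Q)\<^sub>j\<^sub>'\<^sub>j X m m' + Q\<^sub>j\<^sub>'\<^sub>j X (m - 1) (m' - 1)\<close>. All indices are eventually driven into
  \<open>{0, -1, -2}\<close>, where the recursion is a small linear system. If neither condition holds, its hermitian solutions are
  scalar (here \<open>1 + Q (N - 1) 0 \<noteq> 0\<close> because \<open>Q\<close> is a projection), so \<open>P\<close> is \<open>0\<close> or \<open>1\<close>. Conversely, under (a) the
  vector \<open>e\<^sub>0\<close>, and under (b) the vector \<open>e\<^sub>-\<^sub>1\<close>, is a common eigenvector of all \<open>T\<^sub>i\<^sup>*\<close>, and the annihilator of its orbit is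
  a nontrivial reducing subspace.
\<close>

text \<open>The cancellation comes from A(z) = C + z D with C = V (1 - Q) and D = V Q: the ranges of
  C and D are orthogonal, and V is unitary, so it drops out of every product of an adjoint with a
  matrix. The adjoint of \<open>T i\<close> sends the basis vector with index j + N m to a
  combination of those with indices m and m - 1. Around the centre -1 this motion of indices is
  contracting until it reaches {-2, -1, 0}; for N = 2 the index -3 would persist too, since -3 = 1 +
  2 (-2) leads to -2 and -3, and this is where N > 2 enters. An obstacle is that
  \<open>L2_adjoint\<close> is a mere choice and that functions only represent classes modulo null
  functions. Hence operators are handled weakly, through inner products with the basis, and the
  projection appears as a family of chosen vectors \<open>P k\<close> instead of an operator. Two
  analytic facts lead back from Fourier coefficients to subspaces: closed subspaces admit orthogonal
  projections, and a function whose Fourier coefficients all vanish is null.\<close>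

lemma space_circle [simp]: "space circle_measure = sphere 0 1"
  by (simp add: circle_measure_def space_restrict_space)

lemma sets_circle [measurable_cong, simp]:
  "sets circle_measure = sets (restrict_space borel (sphere 0 1))"
  by (simp add: circle_measure_def)

interpretation circle: finite_measure circle_measure
  by (rule finite_measureI) (simp only: prob_space_circle_measure, simp)

lemma measure_circle [simp]: "measure circle_measure (sphere 0 1) = 1"
  using prob_space_circle_measure by (simp add: measure_def)

lemma norm_circle [simp]: "z \<in> space circle_measure \<Longrightarrow> norm z = 1"
  by simp

lemma borel_measurable_circleI: "f \<in> borel_measurable borel \<Longrightarrow> f \<in> borel_measurable circle_measure"
  by (simp add: measurable_cong_sets[OF sets_circle refl] measurable_restrict_space1)

lemma measurable_into_circle:
  assumes "f \<in> borel_measurable M" "\<And>x. x \<in> space M \<Longrightarrow> norm (f x) = 1"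
  shows "f \<in> measurable M circle_measure"
  using assms by (auto simp: measurable_cong_sets[OF refl sets_circle] intro!: measurable_restrict_space2)

lemma measurable_cis [measurable]: "cis \<in> borel_measurable borel"
  by (intro borel_measurable_continuous_onI continuous_intros)

lemma measurable_cis_circle: "cis \<in> measurable lborel circle_measure"
  by (rule measurable_into_circle) auto

text \<open>Written with a real-valued density, the measure fits the transfer rules for integrals
  over image measures and densities.\<close>

lemma circle_measure_density:
  "circle_measure = distr (density lborel (\<lambda>t. ennreal (indicator {0..<2 * pi} t / (2 * pi))))
     (restrict_space borel (sphere 0 1)) cis"
proof -
  have "(\<lambda>t::real. indicator {0..<2 * pi} t / emeasure lborel {0..<2 * pi}) =
    (\<lambda>t. ennreal (indicator {0..<2 * pi} t / (2 * pi)))"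
    by (auto simp: fun_eq_iff indicator_def divide_ennreal[symmetric] simp flip: ennreal_1)
  then show ?thesis
    by (simp add: circle_measure_def uniform_measure_def)
qed

text \<open>The affine substitution behind averaging over roots is a fact about Lebesgue measure on
  the line, so integrals over the circle are moved to [0, 2 pi).\<close>

lemma
  fixes f :: "complex \<Rightarrow> 'b::{banach, second_countable_topology}"
  assumes f: "f \<in> borel_measurable circle_measure"
  shows integrable_circle_iff: "integrable circle_measure f \<longleftrightarrow>
      set_integrable lborel {0..<2 * pi} (\<lambda>t. f (cis t))" (is ?A)
    and integral_circle: "integral\<^sup>L circle_measure f =
      (1 / (2 * pi)) *\<^sub>R (LBINT t:{0..<2 * pi}. f (cis t))" (is ?B)
proof -
  have f': "f \<in> borel_measurable (restrict_space borel (sphere 0 1))"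
    using f by (simp add: measurable_cong_sets[OF sets_circle refl])
  have cis: "cis \<in> measurable (density lborel (\<lambda>t. ennreal (indicator {0..<2 * pi} t / (2 * pi))))
      (restrict_space borel (sphere 0 1))"
    using measurable_cis_circle by (simp add: measurable_cong_sets[OF refl sets_circle])
  have fc: "(\<lambda>t. f (cis t)) \<in> borel_measurable lborel"
    by (rule measurable_compose[OF measurable_cis_circle f])
  have eq: "(indicator {0..<2 * pi} t / (2 * pi)) *\<^sub>R f (cis t) =
      (1 / (2 * pi)) *\<^sub>R (indicator {0..<2 * pi} t *\<^sub>R f (cis t))" for t
    by (simp add: field_simps)
  have scale: "integrable lborel (\<lambda>t. (1 / (2 * pi)) *\<^sub>R g t) \<longleftrightarrow> integrable lborel g" for g :: "real \<Rightarrow> 'b"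
    using integrable_scaleR_right[of "2 * pi" lborel "\<lambda>t. (1 / (2 * pi)) *\<^sub>R g t"]
    by (auto intro: integrable_scaleR_right)
  show ?A
    unfolding circle_measure_density
    by (subst integrable_distr_eq[OF cis f'], subst integrable_density)
       (use fc in \<open>auto simp only: eq scale set_integrable_def, auto\<close>)
  show ?B
    unfolding circle_measure_density
    by (subst integral_distr[OF cis f'], subst integral_density)
       (use fc in \<open>auto simp: eq set_lebesgue_integral_def simp del: scaleR_scaleR\<close>)
qed

section \<open>Averaging over roots\<close>

text \<open>The k-th branch of the N-th root. With the argument taken in [0, 2 pi), branch k sweeps
  exactly the arc of angles from 2 pi k / N to 2 pi (k + 1) / N, so the branches tile the
  circle.\<close>

definition circle_root :: "nat \<Rightarrow> nat \<Rightarrow> complex \<Rightarrow> complex" where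
  "circle_root N k w = cis ((Arg2pi w + 2 * pi * k) / N)"

lemma norm_circle_root [simp]: "norm (circle_root N k w) = 1"
  by (simp add: circle_root_def)

lemma Arg2pi_cis: "0 \<le> t \<Longrightarrow> t < 2 * pi \<Longrightarrow> Arg2pi (cis t) = t"
  by (rule Arg2pi_unique[of 1]) (auto simp: cis_conv_exp)

lemma cis_Arg2pi: "norm w = 1 \<Longrightarrow> cis (Arg2pi w) = w"
  by (simp add: complex_norm_eq_1_exp cis_conv_exp)

lemma circle_root_power:
  assumes "N > 0" "norm w = 1"
  shows "circle_root N k w ^ N = w"
proof -
  have "circle_root N k w ^ N = cis (Arg2pi w + 2 * pi * k)"
    unfolding circle_root_def Complex.DeMoivre using assms by simp
  also have "\<dots> = cis (Arg2pi w)"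
    by (simp add: cis_mult[symmetric] cis_multiple_2pi)
  finally show ?thesis
    using assms by (simp add: cis_Arg2pi)
qed

text \<open>\<open>Arg2pi\<close> jumps along the positive real axis, but its sublevel sets are
  closed.\<close>

lemma measurable_Arg2pi [measurable]: "Arg2pi \<in> borel_measurable borel"
  by (rule borel_measurable_iff_le[THEN iffD2]) (auto intro!: borel_closed closed_Arg2pi2pi_le)

lemma measurable_circle_root: "circle_root N k \<in> measurable circle_measure circle_measure"
  by (rule measurable_into_circle)
     (auto simp: circle_root_def[abs_def] intro!: borel_measurable_circleI)

text \<open>The interval [0, 2 pi) is cut into N arcs and each is stretched back to [0, 2 pi) by an
  affine substitution with factor 1 / N. Both the invariance under z -> z^N and the formula for the
  adjoints rest on this.\<close>

lemma
  fixes f :: "complex \<Rightarrow> 'b::{banach, second_countable_topology}"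
  assumes N: "N > 0" and f: "integrable circle_measure f"
  shows integrable_circle_root: "k < N \<Longrightarrow> integrable circle_measure (\<lambda>w. f (circle_root N k w))" (is "_ \<Longrightarrow> ?A k")
    and integral_circle_root: "integral\<^sup>L circle_measure f =
      (1 / N) *\<^sub>R (\<Sum>k<N. LINT w|circle_measure. f (circle_root N k w))" (is ?B)
proof -
  define I where "I k = {2 * pi * real k / N ..< 2 * pi * real (Suc k) / N}" for k
  have fm: "f \<in> borel_measurable circle_measure"
    using f by auto
  have frm: "(\<lambda>w. f (circle_root N k w)) \<in> borel_measurable circle_measure" for k
    by (rule measurable_compose[OF measurable_circle_root fm])
  have int: "set_integrable lborel {0..<2 * pi} (\<lambda>t. f (cis t))"
    using f by (simp add: integrable_circle_iff[OF fm])
  have sub: "I k \<subseteq> {0..<2 * pi}" if "k < N" for k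
  proof -
    have "2 * pi * real (Suc k) \<le> 2 * pi * N"
      using that by (intro mult_left_mono) auto
    then have "2 * pi * real (Suc k) / N \<le> 2 * pi"
      using that by (simp add: divide_le_eq)
    then show ?thesis by (auto simp: I_def intro: order.trans[rotated])
  qed
  have intI: "set_integrable lborel (I k) (\<lambda>t. f (cis t))" if "k < N" for k
    using int by (rule set_integrable_subset) (use sub[OF that] in \<open>auto simp: I_def\<close>)
  have affine: "indicator (I k) (2 * pi * k / N + (1 / N) * s) *\<^sub>R f (cis (2 * pi * k / N + (1 / N) * s)) =
      indicator {0..<2 * pi} s *\<^sub>R f (circle_root N k (cis s))" for k s
  proof -
    have "2 * pi * k / N + (1 / N) * s \<in> I k \<longleftrightarrow> s \<in> {0..<2 * pi}"
      using N by (auto simp: I_def field_simps)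
    moreover have "cis (2 * pi * k / N + (1 / N) * s) = circle_root N k (cis s)" if "s \<in> {0..<2 * pi}"
      using that by (simp add: circle_root_def Arg2pi_cis add_divide_distrib add.commute)
    ultimately show ?thesis by (auto simp: indicator_def)
  qed
  show "?A k" if "k < N" for k
    unfolding integrable_circle_iff[OF frm]
    using lborel_integrable_real_affine[OF intI[OF that, unfolded set_integrable_def], of "1 / N" "2 * pi * k / N"] N
    by (simp only: affine set_integrable_def) simp
  have "(LBINT t:I k. f (cis t)) = (1 / N) *\<^sub>R (LBINT t:{0..<2 * pi}. f (circle_root N k (cis t)))" for k
    unfolding set_lebesgue_integral_def
    by (subst lborel_integral_real_affine[where c = "1 / N" and t = "2 * pi * k / N"]) (use N in \<open>simp, simp only: affine, simp\<close>)
  then have I: "(1 / (2 * pi)) *\<^sub>R (LBINT t:I k. f (cis t)) =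
      (1 / N) *\<^sub>R (LINT w|circle_measure. f (circle_root N k w))" for k
    by (simp add: integral_circle[OF frm])
  have ind: "indicator {0..<2 * pi} t *\<^sub>R f (cis t) = (\<Sum>k<N. indicator (I k) t *\<^sub>R f (cis t))" for t
  proof (cases "t \<in> {0..<2 * pi}")
    case True
    \<comment> \<open>The index of the only arc that contains t.\<close>
    define k0 where "k0 = nat \<lfloor>N * t / (2 * pi)\<rfloor>"
    have mem: "t \<in> I k \<longleftrightarrow> k = k0" for k
    proof -
      have "t \<in> I k \<longleftrightarrow> real k \<le> N * t / (2 * pi) \<and> N * t / (2 * pi) < real k + 1"
        using N by (auto simp: I_def field_simps)
      also have "\<dots> \<longleftrightarrow> \<lfloor>N * t / (2 * pi)\<rfloor> = int k"
        by (simp add: floor_eq_iff)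
      also have "\<dots> \<longleftrightarrow> k = k0"
        using True by (auto simp: k0_def)
      finally show ?thesis .
    qed
    have "N * t / (2 * pi) < N"
      using True N by (simp add: field_simps)
    then have "k0 < N"
      using True by (auto simp: k0_def nat_less_iff floor_less_iff)
    then show ?thesis using True by (simp add: indicator_def mem of_bool_def if_distrib[of "\<lambda>x. x *\<^sub>R _"] cong: if_cong)
  next
    case False
    then have "t \<notin> I k" if "k < N" for k
      using sub[OF that] by blast
    with False show ?thesis by simp
  qed
  have "(LBINT t:{0..<2 * pi}. f (cis t)) = (\<Sum>k<N. LBINT t:I k. f (cis t))"
    unfolding set_lebesgue_integral_def ind
    by (rule Bochner_Integration.integral_sum) (use intI in \<open>auto simp: set_integrable_def\<close>)
  then show ?B
    by (simp add: integral_circle[OF fm] scaleR_sum_right I)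
qed

section \<open>Projections in the space of square-integrable functions\<close>

lemma L2_measurable [measurable_dest]: "f \<in> L2 \<Longrightarrow> f \<in> borel_measurable circle_measure"
  by (simp add: L2_def)

lemma L2_integrable: "f \<in> L2 \<Longrightarrow> integrable circle_measure (\<lambda>z. (cmod (f z))\<^sup>2)"
  by (simp add: L2_def)

lemma L2_I:
  assumes [measurable]: "f \<in> borel_measurable circle_measure"
    and "integrable circle_measure g" "\<And>z. norm z = 1 \<Longrightarrow> (cmod (f z))\<^sup>2 \<le> g z"
  shows "f \<in> L2"
proof -
  have "integrable circle_measure (\<lambda>z. (cmod (f z))\<^sup>2)"
    by (rule Bochner_Integration.integrable_bound[OF assms(2)])
       (use assms(3) in \<open>auto intro!: AE_I2 intro: order.trans[OF _ abs_ge_self]\<close>)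
  then show ?thesis by (simp add: L2_def)
qed

lemma norm_add_square_le: "(norm (a + b :: 'a :: real_normed_vector))\<^sup>2 \<le> 2 * (norm a)\<^sup>2 + 2 * (norm b)\<^sup>2"
proof -
  have "(norm (a + b))\<^sup>2 \<le> (norm a + norm b)\<^sup>2"
    by (intro power_mono norm_triangle_ineq) auto
  also have "\<dots> \<le> (norm a + norm b)\<^sup>2 + (norm a - norm b)\<^sup>2"
    by simp
  also have "\<dots> = 2 * (norm a)\<^sup>2 + 2 * (norm b)\<^sup>2"
    by (simp add: power2_eq_square algebra_simps)
  finally show ?thesis .
qed

lemma L2_zero [simp]: "(\<lambda>z. 0) \<in> L2"
  by (simp add: L2_def)

lemma L2_add [intro]:
  assumes "f \<in> L2" "g \<in> L2" shows "(\<lambda>z. f z + g z) \<in> L2"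
proof -
  have [measurable]: "f \<in> borel_measurable circle_measure" "g \<in> borel_measurable circle_measure"
    using assms by (auto dest: L2_measurable)
  show ?thesis
    by (rule L2_I[where g = "\<lambda>z. 2 * (cmod (f z))\<^sup>2 + 2 * (cmod (g z))\<^sup>2"])
       (use assms[THEN L2_integrable] in \<open>auto simp: norm_add_square_le\<close>)
qed

lemma L2_cmult [intro]:
  assumes "f \<in> L2" shows "(\<lambda>z. c * f z) \<in> L2"
  using assms by (simp add: L2_def norm_mult power_mult_distrib borel_measurable_times)

lemma L2_diff [intro]: "f \<in> L2 \<Longrightarrow> g \<in> L2 \<Longrightarrow> (\<lambda>z. f z - g z) \<in> L2"
  using L2_add[of f "\<lambda>z. -1 * g z"] L2_cmult[of g "-1"] by simp

lemma L2_sum: "(\<And>i. i \<in> I \<Longrightarrow> f i \<in> L2) \<Longrightarrow> (\<lambda>z. \<Sum>i\<in>I. f i z) \<in> L2"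
  by (induction I rule: infinite_finite_induct) (auto intro: L2_add)

lemma L2_bounded_mult:
  assumes f: "f \<in> L2" and [measurable]: "h \<in> borel_measurable circle_measure"
    and B: "\<And>z. norm z = 1 \<Longrightarrow> norm (h z) \<le> B"
  shows "(\<lambda>z. h z * f z) \<in> L2"
proof (rule L2_I[where g = "\<lambda>z. B\<^sup>2 * (cmod (f z))\<^sup>2"])
  show "(\<lambda>z. h z * f z) \<in> borel_measurable circle_measure"
    using L2_measurable[OF f] by simp
  show "(cmod (h z * f z))\<^sup>2 \<le> B\<^sup>2 * (cmod (f z))\<^sup>2" if "norm z = 1" for z
    by (simp add: norm_mult power_mult_distrib mult_right_mono power_mono B that)
  show "integrable circle_measure (\<lambda>z. B\<^sup>2 * (cmod (f z))\<^sup>2)"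
    using L2_integrable[OF f] by simp
qed

lemma measurable_cnj [measurable]: "cnj \<in> borel_measurable borel"
  by (intro borel_measurable_continuous_onI continuous_intros)

lemma L2_inner_integrable:
  assumes "f \<in> L2" "g \<in> L2"
  shows "integrable circle_measure (\<lambda>z. cnj (f z) * g z)"
proof -
  have [measurable]: "f \<in> borel_measurable circle_measure" "g \<in> borel_measurable circle_measure"
    using assms by (auto dest: L2_measurable)
  have "cmod (f z) * cmod (g z) \<le> (cmod (f z))\<^sup>2 + (cmod (g z))\<^sup>2" for z
  proof -
    have "2 * cmod (f z) * cmod (g z) \<le> (cmod (f z))\<^sup>2 + (cmod (g z))\<^sup>2"
      by (rule sum_squares_bound)
    moreover have "0 \<le> cmod (f z) * cmod (g z)" by simp
    ultimately show ?thesis by linarith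
  qed
  then have bound: "norm (cnj (f z) * g z) \<le> norm ((cmod (f z))\<^sup>2 + (cmod (g z))\<^sup>2)" for z
    by (simp only: norm_mult complex_mod_cnj real_norm_def abs_of_nonneg add_nonneg_nonneg zero_le_power2)
  show ?thesis
    by (rule Bochner_Integration.integrable_bound[OF Bochner_Integration.integrable_add[OF assms[THEN L2_integrable]]])
       (measurable, intro AE_I2 bound)
qed

lemma L2_inner_add_right:
  "f \<in> L2 \<Longrightarrow> g \<in> L2 \<Longrightarrow> h \<in> L2 \<Longrightarrow> L2_inner f (\<lambda>z. g z + h z) = L2_inner f g + L2_inner f h"
  by (simp add: L2_inner_def distrib_left L2_inner_integrable)

lemma L2_inner_diff_right:
  "f \<in> L2 \<Longrightarrow> g \<in> L2 \<Longrightarrow> h \<in> L2 \<Longrightarrow> L2_inner f (\<lambda>z. g z - h z) = L2_inner f g - L2_inner f h"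
  by (simp add: L2_inner_def right_diff_distrib L2_inner_integrable)

lemma L2_inner_cmult_right: "L2_inner f (\<lambda>z. c * g z) = c * L2_inner f g"
proof -
  have "(\<lambda>z. cnj (f z) * (c * g z)) = (\<lambda>z. c * (cnj (f z) * g z))"
    by (simp add: fun_eq_iff algebra_simps)
  then show ?thesis
    by (simp add: L2_inner_def)
qed

lemma L2_inner_zero_right [simp]: "L2_inner f (\<lambda>z. 0) = 0"
  by (simp add: L2_inner_def)

lemma L2_inner_sum_right:
  assumes "f \<in> L2" "\<And>i. i \<in> I \<Longrightarrow> g i \<in> L2"
  shows "L2_inner f (\<lambda>z. \<Sum>i\<in>I. g i z) = (\<Sum>i\<in>I. L2_inner f (g i))"
  using assms(2)
  by (induction I rule: infinite_finite_induct) (auto simp: L2_inner_add_right[OF assms(1)] L2_sum)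

lemma L2_inner_commute: "L2_inner g f = cnj (L2_inner f g)"
  by (simp add: L2_inner_def mult.commute flip: Bochner_Integration.integral_cnj)

lemma L2_inner_add_left:
  "f \<in> L2 \<Longrightarrow> g \<in> L2 \<Longrightarrow> h \<in> L2 \<Longrightarrow> L2_inner (\<lambda>z. f z + g z) h = L2_inner f h + L2_inner g h"
  by (subst (1 2 3) L2_inner_commute) (simp add: L2_inner_add_right)

lemma L2_inner_diff_left:
  "f \<in> L2 \<Longrightarrow> g \<in> L2 \<Longrightarrow> h \<in> L2 \<Longrightarrow> L2_inner (\<lambda>z. f z - g z) h = L2_inner f h - L2_inner g h"
  by (subst (1 2 3) L2_inner_commute) (simp add: L2_inner_diff_right)

lemma L2_inner_cmult_left: "L2_inner (\<lambda>z. c * f z) g = cnj c * L2_inner f g"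
  by (subst (1 2) L2_inner_commute) (simp add: L2_inner_cmult_right)

lemma L2_norm_nonneg [simp]: "L2_norm f \<ge> 0"
  by (simp add: L2_norm_def)

lemma L2_norm_square: "(L2_norm f)\<^sup>2 = (LINT z|circle_measure. (cmod (f z))\<^sup>2)"
  by (simp add: L2_norm_def)

lemma L2_inner_self: "L2_inner f f = of_real ((L2_norm f)\<^sup>2)"
proof -
  have "cnj (f z) * f z = of_real ((cmod (f z))\<^sup>2)" for z
    by (metis complex_norm_square mult.commute)
  then show ?thesis
    by (simp only: L2_inner_def L2_norm_square integral_complex_of_real)
qed

text \<open>The one expansion from which Cauchy-Schwarz, the triangle inequality, the parallelogram
  law and the minimality argument for projections are all read off, by different choices of
  c.\<close>

lemma L2_norm_add_cmult_square:
  assumes "f \<in> L2" "g \<in> L2"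
  shows "(L2_norm (\<lambda>z. f z + c * g z))\<^sup>2 =
    (L2_norm f)\<^sup>2 + 2 * Re (c * L2_inner f g) + (cmod c)\<^sup>2 * (L2_norm g)\<^sup>2"
proof -
  have "complex_of_real ((L2_norm (\<lambda>z. f z + c * g z))\<^sup>2) =
      L2_inner f f + (c * L2_inner f g + cnj (c * L2_inner f g)) + (c * cnj c) * L2_inner g g"
    using assms unfolding L2_inner_self[symmetric]
    by (simp add: L2_inner_add_left L2_inner_add_right L2_cmult L2_add L2_inner_cmult_left
        L2_inner_cmult_right L2_inner_commute[of g f] algebra_simps)
  also have "\<dots> = of_real ((L2_norm f)\<^sup>2 + 2 * Re (c * L2_inner f g) + (cmod c)\<^sup>2 * (L2_norm g)\<^sup>2)"
    by (simp only: L2_inner_self complex_add_cnj complex_norm_square[symmetric]) simp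
  finally show ?thesis by (simp only: of_real_eq_iff)
qed

lemma L2_Cauchy_Schwarz:
  assumes "f \<in> L2" "g \<in> L2"
  shows "cmod (L2_inner f g) \<le> L2_norm f * L2_norm g"
proof -
  define a where "a = (cmod (L2_inner f g))\<^sup>2"
  \<comment> \<open>Taking the conjugate of the inner product as a factor of the coefficient makes
    the linear term real, which leaves a quadratic in the real parameter t.\<close>
  have *: "2 * t * a \<le> (L2_norm f)\<^sup>2 + t\<^sup>2 * a * (L2_norm g)\<^sup>2" for t :: real
  proof -
    have "0 \<le> (L2_norm (\<lambda>z. f z + (- of_real t * cnj (L2_inner f g)) * g z))\<^sup>2" by simp
    also have "\<dots> = (L2_norm f)\<^sup>2 - 2 * t * a + t\<^sup>2 * a * (L2_norm g)\<^sup>2"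
    proof -
      have "- complex_of_real t * cnj (L2_inner f g) * L2_inner f g = of_real (- t * a)"
        unfolding a_def of_real_mult of_real_minus complex_norm_square by (simp add: mult_ac)
      then show ?thesis
        unfolding L2_norm_add_cmult_square[OF assms]
        by (simp only: Re_complex_of_real) (simp add: a_def norm_mult power_mult_distrib)
    qed
    finally show ?thesis by simp
  qed
  have "a \<le> (L2_norm f)\<^sup>2 * (L2_norm g)\<^sup>2"
  proof (cases "L2_norm g = 0")
    case True
    have "a = 0"
    proof (rule ccontr)
      assume a: "a \<noteq> 0"
      \<comment> \<open>A function of seminorm 0 need not vanish, so this case is real. The bound is
        then linear in t, and a large t contradicts it.\<close>
      define t where "t = ((L2_norm f)\<^sup>2 + 1) / a"
      have "2 * t * a \<le> (L2_norm f)\<^sup>2"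
        using *[of t] True by simp
      moreover have "t * a = (L2_norm f)\<^sup>2 + 1"
        using a by (simp add: t_def)
      ultimately show False
        using zero_le_power2[of "L2_norm f"] by linarith
    qed
    then show ?thesis by simp
  next
    case False
    define n where "n = (L2_norm g)\<^sup>2"
    have n: "n > 0" using False by (simp add: n_def)
    \<comment> \<open>The value t = 1 / n minimizes the quadratic.\<close>
    have "2 * (1 / n) * a \<le> (L2_norm f)\<^sup>2 + (1 / n)\<^sup>2 * a * n"
      using *[of "1 / n"] by (simp only: n_def)
    also have "(1 / n)\<^sup>2 * a * n = (1 / n) * a"
      using n by (simp add: power2_eq_square)
    finally have "a / n \<le> (L2_norm f)\<^sup>2" by simp
    then show ?thesis
      using n by (simp add: pos_divide_le_eq n_def)
  qed
  then have "(cmod (L2_inner f g))\<^sup>2 \<le> (L2_norm f * L2_norm g)\<^sup>2"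
    by (simp only: a_def power_mult_distrib)
  then show ?thesis
    by (rule power2_le_imp_le) simp
qed

lemma L2_norm_triangle:
  assumes "f \<in> L2" "g \<in> L2"
  shows "L2_norm (\<lambda>z. f z + g z) \<le> L2_norm f + L2_norm g"
proof (rule power2_le_imp_le)
  have "Re (L2_inner f g) \<le> L2_norm f * L2_norm g"
    using L2_Cauchy_Schwarz[OF assms] complex_Re_le_cmod order.trans by blast
  then show "(L2_norm (\<lambda>z. f z + g z))\<^sup>2 \<le> (L2_norm f + L2_norm g)\<^sup>2"
    using L2_norm_add_cmult_square[OF assms, of 1] by (simp add: power2_sum)
qed simp

lemma L2_const: "(\<lambda>z. c) \<in> L2"
  by (simp add: L2_def)

lemma L2_imp_integrable:
  assumes "f \<in> L2"
  shows "integrable circle_measure f"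
  using L2_inner_integrable[OF L2_const[of 1] assms] by simp

text \<open>Cauchy-Schwarz against the constant 1, which has norm 1 because the measure has total
  mass 1.\<close>

lemma L2_L1_norm_le:
  assumes "f \<in> L2"
  shows "(LINT z|circle_measure. cmod (f z)) \<le> L2_norm f"
proof -
  have m: "(\<lambda>z. complex_of_real (cmod (f z))) \<in> L2"
    using assms by (auto simp: L2_def)
  have "L2_inner (\<lambda>z. 1) (\<lambda>z. of_real (cmod (f z))) = of_real (LINT z|circle_measure. cmod (f z))"
    by (simp add: L2_inner_def integral_complex_of_real)
  moreover have "L2_norm (\<lambda>z. of_real (cmod (f z))) = L2_norm f" "L2_norm (\<lambda>z. 1) = 1"
    by (simp_all add: L2_norm_def)
  ultimately show ?thesis
    using L2_Cauchy_Schwarz[OF L2_const[of 1] m] by (simp add: abs_le_iff)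
qed

text \<open>Riesz--Fischer for rapidly Cauchy sequences: the increments are summable almost everywhere
  because the \<open>L\<^sup>1\<close>-norm is dominated by the \<open>L\<^sup>2\<close>-norm, and Fatou's lemma upgrades the pointwise limit
  to a limit in norm.\<close>

lemma L2_complete:
  assumes F: "\<And>n::nat. F n \<in> L2"
    and cauchy: "\<And>k m n. k \<le> m \<Longrightarrow> k \<le> n \<Longrightarrow> L2_norm (\<lambda>z. F m z - F n z) \<le> (1 / 2) ^ k"
  obtains g where "g \<in> L2" "(\<lambda>n. L2_norm (\<lambda>z. F n z - g z)) \<longlonglongrightarrow> 0"
proof -
  have [measurable]: "F n \<in> borel_measurable circle_measure" for n
    using F by (rule L2_measurable)
  define D where "D n z = cmod (F (Suc n) z - F n z)" for n z
  have [measurable]: "D n \<in> borel_measurable circle_measure" for n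
    unfolding D_def by measurable
  have D: "(\<integral>\<^sup>+z. ennreal (D n z) \<partial>circle_measure) \<le> ennreal ((1 / 2) ^ n)" for n
  proof -
    have L: "(\<lambda>z. F (Suc n) z - F n z) \<in> L2" using F by auto
    have "(LINT z|circle_measure. D n z) \<le> (1 / 2) ^ n"
      using L2_L1_norm_le[OF L] cauchy[of n "Suc n" n] by (simp add: D_def)
    then show ?thesis
      using L2_imp_integrable[OF L] by (subst nn_integral_eq_integral) (auto simp: D_def[abs_def])
  qed
  have "(\<integral>\<^sup>+z. (\<Sum>n. ennreal (D n z)) \<partial>circle_measure) = (\<Sum>n. \<integral>\<^sup>+z. ennreal (D n z) \<partial>circle_measure)"
    by (rule nn_integral_suminf) measurable
  also have "\<dots> \<le> (\<Sum>n. ennreal ((1 / 2) ^ n))"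
    by (intro suminf_le D) auto
  also have "\<dots> = ennreal (\<Sum>n. (1 / 2) ^ n)"
    by (intro suminf_ennreal2) (auto simp: summable_geometric)
  finally have "(\<integral>\<^sup>+z. (\<Sum>n. ennreal (D n z)) \<partial>circle_measure) < \<infinity>"
    by (rule le_less_trans) simp
  then have "AE z in circle_measure. (\<Sum>n. ennreal (D n z)) \<noteq> \<infinity>"
    by (intro nn_integral_PInf_AE) (auto simp: less_top)
  then have conv: "AE z in circle_measure. (\<lambda>n. F n z) \<longlonglongrightarrow> lim (\<lambda>n. F n z)"
  proof eventually_elim
    case (elim z)
    have "summable (\<lambda>n. D n z)"
    proof (rule summable_suminf_not_top[folded infinity_ennreal_def])
      show "0 \<le> D n z" for n by (simp add: D_def)
      show "(\<Sum>n. ennreal (D n z)) \<noteq> \<infinity>" using elim .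
    qed
    then have "summable (\<lambda>n. F (Suc n) z - F n z)"
      unfolding D_def by (rule summable_norm_cancel)
    then have "convergent (\<lambda>n. \<Sum>k<n. F (Suc k) z - F k z)"
      by (simp add: summable_iff_convergent)
    then have "convergent (\<lambda>n. F n z - F 0 z)"
      by (simp add: sum_lessThan_telescope[of "\<lambda>k. F k z"])
    then have "convergent (\<lambda>n. F n z)"
      by (simp add: convergent_diff_const_right_iff)
    then show ?case by (rule convergent_LIMSEQ_iff[THEN iffD1])
  qed
  \<comment> \<open>Off the convergence set \<open>lim\<close> returns an arbitrary value; that set
    is null, and \<open>g\<close> is measurable all the same.\<close>
  define g where "g z = lim (\<lambda>n. F n z)" for z
  have gm [measurable]: "g \<in> borel_measurable circle_measure"
    unfolding g_def by (rule borel_measurable_lim_metric) simp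
  have bound: "(\<integral>\<^sup>+z. ennreal ((cmod (F n z - g z))\<^sup>2) \<partial>circle_measure) \<le> ennreal (((1 / 2) ^ n)\<^sup>2)" for n
  proof -
    have "(\<integral>\<^sup>+z. ennreal ((cmod (F n z - g z))\<^sup>2) \<partial>circle_measure) =
        (\<integral>\<^sup>+z. liminf (\<lambda>m. ennreal ((cmod (F n z - F m z))\<^sup>2)) \<partial>circle_measure)"
    proof (rule nn_integral_cong_AE)
      show "AE z in circle_measure. ennreal ((cmod (F n z - g z))\<^sup>2) =
          liminf (\<lambda>m. ennreal ((cmod (F n z - F m z))\<^sup>2))"
        using conv
      proof eventually_elim
        case (elim z)
        then have "(\<lambda>m. ennreal ((cmod (F n z - F m z))\<^sup>2)) \<longlonglongrightarrow> ennreal ((cmod (F n z - g z))\<^sup>2)"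
          unfolding g_def by (intro tendsto_ennrealI tendsto_intros)
        then show ?case
          by (rule lim_imp_Liminf[OF sequentially_bot, symmetric])
      qed
    qed
    also have "\<dots> \<le> liminf (\<lambda>m. \<integral>\<^sup>+z. ennreal ((cmod (F n z - F m z))\<^sup>2) \<partial>circle_measure)"
      by (rule nn_integral_liminf) measurable
    also have "\<dots> \<le> limsup (\<lambda>m. \<integral>\<^sup>+z. ennreal ((cmod (F n z - F m z))\<^sup>2) \<partial>circle_measure)"
      by (rule Liminf_le_Limsup) simp
    also have "\<dots> \<le> ennreal (((1 / 2) ^ n)\<^sup>2)"
    proof (rule Limsup_bounded, rule eventually_sequentiallyI[of n])
      fix m assume "n \<le> m"
      have L: "(\<lambda>z. F n z - F m z) \<in> L2" using F by auto
      have "(\<integral>\<^sup>+z. ennreal ((cmod (F n z - F m z))\<^sup>2) \<partial>circle_measure) =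
          ennreal ((L2_norm (\<lambda>z. F n z - F m z))\<^sup>2)"
        using L2_integrable[OF L] by (simp add: nn_integral_eq_integral L2_norm_square)
      also have "\<dots> \<le> ennreal (((1 / 2) ^ n)\<^sup>2)"
        using cauchy[of n n m] \<open>n \<le> m\<close> by (intro ennreal_leI power_mono) auto
      finally show "(\<integral>\<^sup>+z. ennreal ((cmod (F n z - F m z))\<^sup>2) \<partial>circle_measure) \<le> ennreal (((1 / 2) ^ n)\<^sup>2)" .
    qed
    finally show ?thesis .
  qed
  have L: "(\<lambda>z. F n z - g z) \<in> L2" for n
  proof -
    have "integrable circle_measure (\<lambda>z. (cmod (F n z - g z))\<^sup>2)"
      using bound[of n] by (intro integrableI_bounded) (auto intro: le_less_trans)
    then show ?thesis by (simp add: L2_def)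
  qed
  have "g \<in> L2"
    using L2_diff[OF F[of 0] L[of 0]] by simp
  moreover have "L2_norm (\<lambda>z. F n z - g z) \<le> (1 / 2) ^ n" for n
  proof (rule power2_le_imp_le)
    show "(L2_norm (\<lambda>z. F n z - g z))\<^sup>2 \<le> ((1 / 2) ^ n)\<^sup>2"
      using bound[of n] L2_integrable[OF L[of n]]
      by (simp add: nn_integral_eq_integral L2_norm_square ennreal_le_iff)
  qed simp
  then have "(\<lambda>n. L2_norm (\<lambda>z. F n z - g z)) \<longlonglongrightarrow> 0"
    by (intro Lim_null_comparison[OF always_eventually LIMSEQ_realpow_zero[of "1 / 2"]]) auto
  ultimately show ?thesis by (rule that)
qed

section \<open>Closed subspaces and orthogonal projection\<close>

lemma closed_subspace_L2: "closed_subspace M \<Longrightarrow> f \<in> M \<Longrightarrow> f \<in> L2"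
  by (auto simp: closed_subspace_def)

lemma closed_subspace_zero: "closed_subspace M \<Longrightarrow> (\<lambda>z. 0) \<in> M"
  by (auto simp: closed_subspace_def)

lemma closed_subspace_add: "closed_subspace M \<Longrightarrow> f \<in> M \<Longrightarrow> g \<in> M \<Longrightarrow> (\<lambda>z. f z + g z) \<in> M"
  by (auto simp: closed_subspace_def)

lemma closed_subspace_cmult: "closed_subspace M \<Longrightarrow> f \<in> M \<Longrightarrow> (\<lambda>z. c * f z) \<in> M"
  by (auto simp: closed_subspace_def)

lemma closed_subspace_limit:
  "closed_subspace M \<Longrightarrow> (\<And>n::nat. F n \<in> M) \<Longrightarrow> g \<in> L2 \<Longrightarrow>
    (\<lambda>n. L2_norm (\<lambda>z. F n z - g z)) \<longlonglongrightarrow> 0 \<Longrightarrow> g \<in> M"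
  unfolding closed_subspace_def by blast

lemma closed_subspace_projection:
  assumes M: "closed_subspace M" and f: "f \<in> L2"
  obtains p where "p \<in> M" "\<And>g. g \<in> M \<Longrightarrow> L2_inner g (\<lambda>z. f z - p z) = 0"
proof -
  define S where "S = (\<lambda>g. (L2_norm (\<lambda>z. f z - g z))\<^sup>2) ` M"
  define d where "d = Inf S"
  have bdd: "bdd_below S"
    by (auto simp: S_def intro!: bdd_belowI[of _ 0])
  have ne: "S \<noteq> {}"
    using closed_subspace_zero[OF M] by (auto simp: S_def)
  have d_le: "d \<le> (L2_norm (\<lambda>z. f z - g z))\<^sup>2" if "g \<in> M" for g
    unfolding d_def by (rule cInf_lower[OF _ bdd]) (use that in \<open>auto simp: S_def\<close>)
  \<comment> \<open>The margin is tuned to the parallelogram law: it yields (1/4)^m / 2 + (1/4)^n /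
    2 for the squared distance of \<open>G m\<close> and \<open>G n\<close>, which is at most
    ((1/2)^k)^2, the rate that \<open>L2_complete\<close> asks for.\<close>
  have "\<exists>g\<in>M. (L2_norm (\<lambda>z. f z - g z))\<^sup>2 < d + (1 / 4) ^ n / 4" for n :: nat
    using cInf_lessD[OF ne, of "d + (1 / 4) ^ n / 4"] by (auto simp: d_def S_def)
  then obtain G where G: "\<And>n. G n \<in> M"
      and Gd: "\<And>n::nat. (L2_norm (\<lambda>z. f z - G n z))\<^sup>2 < d + (1 / 4) ^ n / 4"
    by metis
  have GL: "G n \<in> L2" for n
    using G closed_subspace_L2[OF M] by auto
  have "L2_norm (\<lambda>z. G m z - G n z) \<le> (1 / 2) ^ k" if mn: "k \<le> m" "k \<le> n" for k m n
  proof (rule power2_le_imp_le)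
    define u where "u z = f z - G m z" for z
    define v where "v z = f z - G n z" for z
    have uv: "u \<in> L2" "v \<in> L2" using f GL by (auto simp: u_def[abs_def] v_def[abs_def])
    \<comment> \<open>The midpoint lies in the subspace, so its squared distance from
      \<open>f\<close> is at least \<open>d\<close>; this is the lower bound used in the
      parallelogram law.\<close>
    have h: "(\<lambda>z. (1 / 2) * (G m z + G n z)) \<in> M"
      using M G by (intro closed_subspace_cmult closed_subspace_add)
    have "(\<lambda>z. u z + 1 * v z) = (\<lambda>z. 0 + 2 * (f z - (1 / 2) * (G m z + G n z)))"
      by (simp add: u_def v_def fun_eq_iff algebra_simps)
    then have plus: "(L2_norm (\<lambda>z. u z + 1 * v z))\<^sup>2 =
        4 * (L2_norm (\<lambda>z. f z - (1 / 2) * (G m z + G n z)))\<^sup>2"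
      using L2_norm_add_cmult_square[OF L2_zero L2_diff[OF f closed_subspace_L2[OF M h]], of 2]
      by (simp add: L2_norm_def[of "\<lambda>z. 0"] L2_inner_def)
    have "(\<lambda>z. u z + (- 1) * v z) = (\<lambda>z. (-1) * (G m z - G n z))"
      by (simp add: u_def v_def fun_eq_iff)
    then have minus: "L2_norm (\<lambda>z. u z + (- 1) * v z) = L2_norm (\<lambda>z. G m z - G n z)"
      by (simp add: L2_norm_def norm_minus_commute)
    have "(L2_norm (\<lambda>z. u z + 1 * v z))\<^sup>2 + (L2_norm (\<lambda>z. u z + (- 1) * v z))\<^sup>2 =
        2 * (L2_norm u)\<^sup>2 + 2 * (L2_norm v)\<^sup>2"
      unfolding L2_norm_add_cmult_square[OF uv] by simp
    then have "(L2_norm (\<lambda>z. G m z - G n z))\<^sup>2 \<le> 2 * (L2_norm u)\<^sup>2 + 2 * (L2_norm v)\<^sup>2 - 4 * d"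
      using d_le[OF h] plus minus by simp
    also have "\<dots> \<le> (1 / 4) ^ m / 2 + (1 / 4) ^ n / 2"
      using Gd[of m] Gd[of n] by (simp add: u_def[abs_def] v_def[abs_def])
    also have "\<dots> \<le> (1 / 4) ^ k / 2 + (1 / 4) ^ k / 2"
      using mn by (intro add_mono divide_right_mono power_decreasing) auto
    also have "\<dots> = ((1 / 2) ^ k)\<^sup>2"
      by (simp add: power2_eq_square flip: power_mult_distrib)
    finally show "(L2_norm (\<lambda>z. G m z - G n z))\<^sup>2 \<le> ((1 / 2) ^ k)\<^sup>2" .
  qed simp
  then obtain p where p: "p \<in> L2" and lim: "(\<lambda>n. L2_norm (\<lambda>z. G n z - p z)) \<longlonglongrightarrow> 0"
    by (rule L2_complete[OF GL])
  have pM: "p \<in> M" by (rule closed_subspace_limit[OF M G p lim])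
  define r where "r z = f z - p z" for z
  have r: "r \<in> L2" using f p by (auto simp: r_def[abs_def])
  have "d \<ge> 0"
    unfolding d_def by (rule cInf_greatest[OF ne]) (auto simp: S_def)
  have "L2_norm r \<le> sqrt d"
  proof (rule tendsto_lowerbound)
    have "(\<lambda>n. (1 / 4 :: real) ^ n) \<longlonglongrightarrow> 0"
      by (rule LIMSEQ_realpow_zero) auto
    then have "(\<lambda>n. sqrt (d + (1 / 4) ^ n / 4) + L2_norm (\<lambda>z. G n z - p z)) \<longlonglongrightarrow> sqrt (d + 0 / 4) + 0"
      by (intro tendsto_add tendsto_real_sqrt tendsto_divide tendsto_const lim) auto
    then show "(\<lambda>n. sqrt (d + (1 / 4) ^ n / 4) + L2_norm (\<lambda>z. G n z - p z)) \<longlonglongrightarrow> sqrt d" by simp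
    show "\<forall>\<^sub>F n in sequentially. L2_norm r \<le> sqrt (d + (1 / 4) ^ n / 4) + L2_norm (\<lambda>z. G n z - p z)"
    proof (rule always_eventually, rule allI)
      fix n
      have "L2_norm r \<le> L2_norm (\<lambda>z. f z - G n z) + L2_norm (\<lambda>z. G n z - p z)"
        using L2_norm_triangle[OF L2_diff[OF f GL[of n]] L2_diff[OF GL[of n] p]]
        by (simp add: r_def[abs_def])
      moreover have "L2_norm (\<lambda>z. f z - G n z) \<le> sqrt (d + (1 / 4) ^ n / 4)"
        using Gd[of n] by (intro real_le_rsqrt) simp
      ultimately show "L2_norm r \<le> sqrt (d + (1 / 4) ^ n / 4) + L2_norm (\<lambda>z. G n z - p z)" by linarith
    qed
  qed simp
  then have rd: "(L2_norm r)\<^sup>2 \<le> d"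
    using power_mono[of "L2_norm r" "sqrt d" 2] \<open>d \<ge> 0\<close> by simp
  have "L2_inner g (\<lambda>z. f z - p z) = 0" if g: "g \<in> M" for g
  proof -
    have gL: "g \<in> L2" using g closed_subspace_L2[OF M] by auto
    define a where "a = (cmod (L2_inner r g))\<^sup>2"
    \<comment> \<open>A step small enough for the quadratic term to be dominated by the linear one;
      the summand 1 keeps the denominator positive when \<open>g\<close> has norm 0.\<close>
    define t where "t = 1 / (1 + (L2_norm g)\<^sup>2)"
    have t: "t > 0" "t * (L2_norm g)\<^sup>2 \<le> 1"
      by (auto simp: t_def field_simps add_pos_nonneg)
    define c where "c = - of_real t * cnj (L2_inner r g)"
    \<comment> \<open>Moving the minimizer inside the subspace along \<open>g\<close> cannot bring
      it closer to \<open>f\<close>, which forces the inner product with \<open>g\<close> to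
      vanish.\<close>
    have "(\<lambda>z. p z + (- c) * g z) \<in> M"
      using M pM g by (intro closed_subspace_add closed_subspace_cmult)
    from d_le[OF this] have "d \<le> (L2_norm (\<lambda>z. r z + c * g z))\<^sup>2"
      by (simp add: r_def algebra_simps)
    with rd have "(L2_norm r)\<^sup>2 \<le> (L2_norm (\<lambda>z. r z + c * g z))\<^sup>2"
      by (rule order.trans)
    also have "\<dots> = (L2_norm r)\<^sup>2 - 2 * t * a + t\<^sup>2 * a * (L2_norm g)\<^sup>2"
    proof -
      have "c * L2_inner r g = of_real (- t * a)"
        unfolding c_def a_def of_real_mult of_real_minus complex_norm_square by (simp add: mult_ac)
      then show ?thesis
        unfolding L2_norm_add_cmult_square[OF r gL]
        by (simp only: Re_complex_of_real) (simp add: c_def a_def norm_mult power_mult_distrib)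
    qed
    finally have "t * (2 * a) \<le> t * ((t * (L2_norm g)\<^sup>2) * a)"
      by (simp add: power2_eq_square algebra_simps)
    then have "2 * a \<le> (t * (L2_norm g)\<^sup>2) * a"
      using t by simp
    also have "\<dots> \<le> 1 * a"
      using t by (intro mult_right_mono) (auto simp: a_def)
    finally have "a = 0" by (simp add: a_def)
    then show ?thesis
      by (subst L2_inner_commute) (simp add: a_def r_def[abs_def])
  qed
  with pM show ?thesis by (rule that)
qed

section \<open>Fourier basis\<close>

definition circle_exp :: "int \<Rightarrow> complex \<Rightarrow> complex" where
  "circle_exp n z = z powi n"

lemma measurable_circle_exp [measurable]: "circle_exp n \<in> borel_measurable borel"
proof (cases "n \<ge> 0")
  case True
  then show ?thesis by (simp add: circle_exp_def[abs_def] power_int_def)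
next
  case False
  then show ?thesis by (simp add: circle_exp_def[abs_def] power_int_def)
qed

lemma measurable_circle_exp_circle [measurable]: "circle_exp n \<in> borel_measurable circle_measure"
  by (rule borel_measurable_circleI) measurable

lemma norm_circle_exp [simp]: "norm z = 1 \<Longrightarrow> norm (circle_exp n z) = 1"
  by (simp add: circle_exp_def norm_power_int)

lemma circle_exp_0 [simp]: "circle_exp 0 z = 1"
  by (simp add: circle_exp_def)

lemma circle_exp_of_nat: "circle_exp (int n) z = z ^ n"
  by (simp add: circle_exp_def)

lemma circle_exp_add: "norm z = 1 \<Longrightarrow> circle_exp (m + n) z = circle_exp m z * circle_exp n z"
  by (auto simp: circle_exp_def intro!: power_int_add)

lemma cnj_circle_exp: "norm z = 1 \<Longrightarrow> cnj (circle_exp n z) = circle_exp (- n) z"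
proof -
  assume z: "norm z = 1"
  have "circle_exp n z * cnj (circle_exp n z) = 1"
    using z by (simp add: complex_norm_square[symmetric])
  moreover have "circle_exp n z * circle_exp (- n) z = 1"
    using circle_exp_add[OF z, of n "- n"] by simp
  ultimately show ?thesis
    by (metis mult_cancel_left mult_zero_left zero_neq_one)
qed

lemma circle_exp_power: "circle_exp n (z ^ N) = circle_exp (int N * n) z"
  by (simp add: circle_exp_def power_int_mult)

lemma circle_exp_L2 [simp, intro]: "circle_exp n \<in> L2"
  by (rule L2_I[where g = "\<lambda>z. 1"]) auto

text \<open>A geometric sum whose ratio is an N-th root of unity; the bound on r ensures that the
  ratio is 1 only for r = 0.\<close>

lemma sum_circle_exp_root:
  assumes "\<bar>r\<bar> < int N"
  shows "(\<Sum>k<N. circle_exp r (circle_root N k w)) = (if r = 0 then of_nat N else 0)"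
proof (cases "r = 0")
  case False
  have N: "N > 0" using assms by linarith
  define x where "x = cis (2 * pi * of_int r / N)"
  have "circle_exp r (circle_root N k w) = cis (of_int r * Arg2pi w / N) * x ^ k" for k
    by (simp add: circle_exp_def circle_root_def cis_power_int x_def Complex.DeMoivre cis_mult
        add_divide_distrib algebra_simps)
  then have "(\<Sum>k<N. circle_exp r (circle_root N k w)) = cis (of_int r * Arg2pi w / N) * (\<Sum>k<N. x ^ k)"
    by (simp add: sum_distrib_left)
  moreover have "x \<noteq> 1"
  proof
    assume "x = 1"
    then obtain n :: int where "2 * pi * of_int r / N = of_int (2 * n) * pi"
      by (auto simp: x_def cis_conv_exp exp_eq_1)
    then have "real_of_int r = of_int (n * int N)"
      using N by (simp add: field_simps)
    then have "r = n * int N" by (simp only: of_int_eq_iff)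
    with False assms show False
      by (metis abs_mult abs_of_nat dvd_imp_le_int dvd_triv_right leD)
  qed
  moreover have "x ^ N = 1"
    using N cis_multiple_2pi[of "of_int r"] by (simp add: x_def Complex.DeMoivre)
  ultimately show ?thesis
    using False by (simp add: geometric_sum)
qed simp

section \<open>Invariance of Haar measure under power maps and Fourier orthogonality\<close>

lemma measurable_power_circle: "(\<lambda>z. z ^ N) \<in> measurable circle_measure circle_measure"
  by (rule measurable_into_circle) (auto simp: norm_power intro!: borel_measurable_circleI)

text \<open>All N roots of w return to w under the power map, so averaging the indicator of a
  preimage over the roots gives back the indicator of the set.\<close>

lemma distr_power_circle:
  assumes "N > 0"
  shows "distr circle_measure circle_measure (\<lambda>z. z ^ N) = circle_measure"
proof (rule measure_eqI)
  fix B assume "B \<in> sets (distr circle_measure circle_measure (\<lambda>z. z ^ N))"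
  then have B: "B \<in> sets circle_measure" by (simp del: sets_circle)
  have V: "(\<lambda>z. z ^ N) -` B \<inter> space circle_measure \<in> sets circle_measure"
    by (rule measurable_sets[OF measurable_power_circle B])
  have "measure circle_measure ((\<lambda>z. z ^ N) -` B \<inter> space circle_measure) =
      (LINT z|circle_measure. indicator ((\<lambda>z. z ^ N) -` B \<inter> space circle_measure) z)"
    using V by simp
  also have "\<dots> = (1 / N) *\<^sub>R (\<Sum>k<N. LINT w|circle_measure.
      indicator ((\<lambda>z. z ^ N) -` B \<inter> space circle_measure) (circle_root N k w))"
    by (rule integral_circle_root[OF assms]) (intro integrable_real_indicator V, simp add: less_top[symmetric])
  also have "\<dots> = (1 / N) *\<^sub>R (\<Sum>k<N. LINT w|circle_measure. indicator B w)"
    by (intro arg_cong[of _ _ "scaleR _"] sum.cong Bochner_Integration.integral_cong)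
       (use assms in \<open>auto simp: circle_root_power indicator_def\<close>)
  also have "\<dots> = measure circle_measure B"
    using assms B sets.sets_into_space[OF B] by (simp add: Int_absorb2 del: sets_circle)
  finally show "emeasure (distr circle_measure circle_measure (\<lambda>z. z ^ N)) B = emeasure circle_measure B"
    using B by (subst emeasure_distr[OF measurable_power_circle]) (simp_all add: circle.emeasure_eq_measure del: sets_circle)
qed simp

lemma integrable_compose_power:
  fixes f :: "complex \<Rightarrow> 'b::{banach, second_countable_topology}"
  assumes "N > 0" "integrable circle_measure f"
  shows "integrable circle_measure (\<lambda>z. f (z ^ N))"
  using assms(2) integrable_distr[OF measurable_power_circle, of N f] distr_power_circle[OF assms(1)] by simp

lemma L2_compose_power: "N > 0 \<Longrightarrow> f \<in> L2 \<Longrightarrow> (\<lambda>z. f (z ^ N)) \<in> L2"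
  using integrable_compose_power[of N "\<lambda>z. (cmod (f z))\<^sup>2"] measurable_compose[OF measurable_power_circle]
  by (auto simp: L2_def)

lemma integrable_bounded_mult:
  fixes f h :: "complex \<Rightarrow> complex"
  assumes "integrable circle_measure f" "h \<in> borel_measurable circle_measure"
    "\<And>z. norm z = 1 \<Longrightarrow> norm (h z) \<le> B"
  shows "integrable circle_measure (\<lambda>z. h z * f z)"
proof (rule Bochner_Integration.integrable_bound)
  show "integrable circle_measure (\<lambda>z. of_real B * f z)" using assms by simp
  show "AE z in circle_measure. norm (h z * f z) \<le> norm (of_real B * f z)"
    using assms(3) by (intro AE_I2) (auto simp: norm_mult intro!: mult_right_mono order.trans[OF _ abs_ge_self])
qed (use assms in auto)

text \<open>The factor h(z^N) is constant on the N roots of a point, so averaging acts on the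
  exponential alone. This gives the orthogonality of different residues modulo N.\<close>

lemma integral_circle_exp_mult_compose_power:
  fixes h :: "complex \<Rightarrow> complex"
  assumes h: "integrable circle_measure h" and r: "\<bar>r\<bar> < int N"
  shows "(LINT z|circle_measure. circle_exp r z * h (z ^ N)) = (if r = 0 then LINT z|circle_measure. h z else 0)"
proof -
  have N: "N > 0" using r by linarith
  have I: "integrable circle_measure (\<lambda>z. circle_exp r z * h (z ^ N))"
    by (rule integrable_bounded_mult[where B = 1]) (use integrable_compose_power[OF N h] in auto)
  have "(LINT z|circle_measure. circle_exp r z * h (z ^ N)) = (1 / N) *\<^sub>R (\<Sum>k<N. LINT w|circle_measure.
      circle_exp r (circle_root N k w) * h (circle_root N k w ^ N))"
    by (rule integral_circle_root[OF N I])
  also have "(\<Sum>k<N. LINT w|circle_measure. circle_exp r (circle_root N k w) * h (circle_root N k w ^ N)) =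
      (LINT w|circle_measure. (\<Sum>k<N. circle_exp r (circle_root N k w) * h (circle_root N k w ^ N)))"
    by (rule Bochner_Integration.integral_sum[symmetric]) (use integrable_circle_root[OF N I] in auto)
  also have "\<dots> = (LINT w|circle_measure. (\<Sum>k<N. circle_exp r (circle_root N k w)) * h w)"
    by (rule Bochner_Integration.integral_cong) (auto simp: circle_root_power N sum_distrib_right)
  also have "\<dots> = (if r = 0 then N * (LINT z|circle_measure. h z) else 0)"
    by (simp add: sum_circle_exp_root[OF r])
  finally show ?thesis using N by (simp add: scaleR_conv_of_real)
qed

lemma integral_circle_exp: "(LINT z|circle_measure. circle_exp n z) = (if n = 0 then 1 else 0)"
proof -
  have "(LINT z|circle_measure. (1 :: complex)) = 1" by simp
  \<comment> \<open>With h = 1 the modulus is free; any number above the absolute value of n will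
    do.\<close>
  then show ?thesis
    using integral_circle_exp_mult_compose_power[of "\<lambda>z. 1" n "nat (\<bar>n\<bar> + 1)"] by simp
qed

lemma L2_inner_circle_exp: "L2_inner (circle_exp m) (circle_exp n) = (if m = n then 1 else 0)"
proof -
  have "L2_inner (circle_exp m) (circle_exp n) = (LINT z|circle_measure. circle_exp (n - m) z)"
    unfolding L2_inner_def
    by (rule Bochner_Integration.integral_cong) (auto simp: cnj_circle_exp simp flip: circle_exp_add)
  then show ?thesis by (simp add: integral_circle_exp)
qed

section \<open>Uniqueness of Fourier coefficients for integrable functions\<close>

definition fourier_null :: "(complex \<Rightarrow> complex) \<Rightarrow> bool" where
  "fourier_null h \<longleftrightarrow> integrable circle_measure h \<and> (\<forall>n. (LINT z|circle_measure. circle_exp n z * h z) = 0)"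

lemma fourier_null_cong:
  assumes "\<And>z. norm z = 1 \<Longrightarrow> g z = h z"
  shows "fourier_null g \<longleftrightarrow> fourier_null h"
proof -
  have "integrable circle_measure g \<longleftrightarrow> integrable circle_measure h"
    by (rule Bochner_Integration.integrable_cong) (use assms in auto)
  moreover have "(LINT z|circle_measure. circle_exp n z * g z) = (LINT z|circle_measure. circle_exp n z * h z)" for n
    by (rule Bochner_Integration.integral_cong) (use assms in auto)
  ultimately show ?thesis by (simp add: fourier_null_def)
qed

lemma integrable_circle_exp_mult:
  "integrable circle_measure h \<Longrightarrow> integrable circle_measure (\<lambda>z. circle_exp n z * h z)"
  by (rule integrable_bounded_mult[where B = 1]) auto

lemma fourier_null_add: "fourier_null g \<Longrightarrow> fourier_null h \<Longrightarrow> fourier_null (\<lambda>z. g z + h z)"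
  by (simp add: fourier_null_def distrib_left integrable_circle_exp_mult)

lemma fourier_null_cmult:
  assumes "fourier_null h" shows "fourier_null (\<lambda>z. c * h z)"
proof -
  have "(\<lambda>z. circle_exp n z * (c * h z)) = (\<lambda>z. c * (circle_exp n z * h z))" for n
    by (simp add: fun_eq_iff)
  then show ?thesis using assms by (simp add: fourier_null_def)
qed

text \<open>Multiplication by an exponential merely shifts the coefficients. Together with
  linearity, this lets trigonometric polynomials act on the functions with vanishing
  coefficients.\<close>

lemma fourier_null_exp:
  assumes "fourier_null h" shows "fourier_null (\<lambda>z. circle_exp m z * h z)"
proof -
  have "(LINT z|circle_measure. circle_exp n z * (circle_exp m z * h z)) =
      (LINT z|circle_measure. circle_exp (n + m) z * h z)" for n
    by (rule Bochner_Integration.integral_cong) (auto simp: circle_exp_add)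
  then show ?thesis using assms by (simp add: fourier_null_def integrable_circle_exp_mult)
qed

text \<open>On the circle a real polynomial in Re z and Im z is a trigonometric polynomial. The
  function h stays arbitrary in the induction because the product case applies one hypothesis to the
  function produced by the other.\<close>

lemma fourier_null_real_polynomial:
  "real_polynomial_function p \<Longrightarrow> fourier_null h \<Longrightarrow> fourier_null (\<lambda>z. of_real (p z) * h z)"
proof (induction p arbitrary: h rule: real_polynomial_function.induct)
  case (linear f)
  \<comment> \<open>The coefficients of z and of its conjugate in Re z f(1) + Im z f(i), from Re z =
    (z + cnj z) / 2 and Im z = (z - cnj z) / (2 i).\<close>
  define a where "a = (of_real (f 1) - \<i> * of_real (f \<i>)) / 2"
  define b where "b = (of_real (f 1) + \<i> * of_real (f \<i>)) / 2"
  have "of_real (f z) * h z = a * (circle_exp 1 z * h z) + b * (circle_exp (-1) z * h z)" if z: "norm z = 1" for z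
  proof -
    interpret bounded_linear f by fact
    have "f z = f (Re z *\<^sub>R 1 + Im z *\<^sub>R \<i>)"
      by (rule arg_cong[of _ _ f]) (simp add: complex_eq_iff)
    then have "f z = Re z * f 1 + Im z * f \<i>"
      by (simp only: add scaleR real_scaleR_def)
    moreover have "circle_exp (-1) z = cnj z" "circle_exp 1 z = z"
      using cnj_circle_exp[OF z, of 1] by (simp_all add: circle_exp_def)
    ultimately show ?thesis
      by (simp add: a_def b_def complex_eq_iff field_simps)
  qed
  note eq = this
  have "fourier_null (\<lambda>z. a * (circle_exp 1 z * h z) + b * (circle_exp (-1) z * h z))"
    using linear.prems by (intro fourier_null_add fourier_null_cmult fourier_null_exp)
  then show ?case
    by (rule fourier_null_cong[THEN iffD2, rotated]) (rule eq)
next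
  case (const c)
  then show ?case by (rule fourier_null_cmult)
next
  case (add f g)
  then show ?case using fourier_null_add[of "\<lambda>z. of_real (f z) * h z" "\<lambda>z. of_real (g z) * h z"]
    by (simp add: distrib_right)
next
  case (mult f g)
  then show ?case using mult.IH(1)[OF mult.IH(2)[OF mult.prems]] by (simp add: mult.assoc)
qed

text \<open>By Stone-Weierstrass, g is uniformly close on the circle to a polynomial, whose integral
  against h is 0; the error is at most e times the L1 norm of h.\<close>

lemma fourier_null_integral_continuous:
  assumes h: "fourier_null h" and g: "continuous_on UNIV (g :: complex \<Rightarrow> real)"
  shows "(LINT z|circle_measure. of_real (g z) * h z) = 0"
proof -
  have hi: "integrable circle_measure h" using h by (simp add: fourier_null_def)
  define B where "B = (LINT z|circle_measure. cmod (h z))"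
  have B: "B \<ge> 0" by (simp add: B_def)
  have gs: "continuous_on (sphere 0 1) g" using g continuous_on_subset by blast
  have gm: "g \<in> borel_measurable borel" using g by (rule borel_measurable_continuous_onI)
  have bound: "cmod (LINT z|circle_measure. of_real (g z) * h z) \<le> e * B" if e: "e > 0" for e
  proof -
    obtain p where p: "real_polynomial_function p" and pe: "\<And>z. z \<in> sphere 0 1 \<Longrightarrow> \<bar>g z - p z\<bar> < e"
      using Stone_Weierstrass_real_polynomial_function[OF compact_sphere gs e] by metis
    have pm: "p \<in> borel_measurable borel"
      using p by (intro borel_measurable_continuous_onI continuous_on_polymonial_function)
        (simp add: real_polynomial_function_eq)
    have ph: "fourier_null (\<lambda>z. of_real (p z) * h z)"
      by (rule fourier_null_real_polynomial[OF p h])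
    then have p0: "(LINT z|circle_measure. of_real (p z) * h z) = 0"
      using circle_exp_0 by (auto simp: fourier_null_def dest: spec[of _ 0])
    have pi: "integrable circle_measure (\<lambda>z. of_real (p z) * h z)"
      using ph by (simp add: fourier_null_def)
    have di: "integrable circle_measure (\<lambda>z. of_real (g z - p z) * h z)"
      by (rule integrable_bounded_mult[OF hi, where B = e])
         (use gm pm pe in \<open>auto intro!: borel_measurable_circleI less_imp_le simp del: of_real_diff\<close>)
    have "(LINT z|circle_measure. of_real (g z) * h z) =
        (LINT z|circle_measure. of_real (g z - p z) * h z + of_real (p z) * h z)"
      by (simp add: algebra_simps)
    also have "\<dots> = (LINT z|circle_measure. of_real (g z - p z) * h z)"
      by (subst Bochner_Integration.integral_add[OF di pi]) (simp only: p0 add_0_right)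
    also have "cmod \<dots> \<le> (LINT z|circle_measure. e * cmod (h z))"
      by (rule Bochner_Integration.integral_norm_bound_integral[OF di])
         (use hi pe[THEN less_imp_le] in \<open>auto simp: norm_mult simp del: of_real_diff intro!: mult_right_mono\<close>)
    finally show ?thesis by (simp add: B_def)
  qed
  have "cmod (LINT z|circle_measure. of_real (g z) * h z) \<le> 0 + e" if "e > 0" for e
  proof -
    \<comment> \<open>Dividing by B + 1 covers the case B = 0.\<close>
    have "e / (B + 1) * B \<le> e"
      using B that by (simp add: field_simps)
    then show ?thesis
      using bound[of "e / (B + 1)"] B that by simp
  qed
  then have "cmod (LINT z|circle_measure. of_real (g z) * h z) \<le> 0"
    by (rule field_le_epsilon)
  then show ?thesis by simp
qed

lemma fourier_null_integral_closed:
  assumes h: "fourier_null h" and C: "closed C"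
  shows "(LINT z|circle_measure. indicator C z *\<^sub>R h z) = 0"
proof (cases "C = {}")
  case False
  have hi: "integrable circle_measure h" using h by (simp add: fourier_null_def)
  \<comment> \<open>Continuous cutoffs decreasing pointwise to the indicator of C. The empty set was
    split off because \<open>infdist\<close> to it is 0 by convention.\<close>
  define g where "g n z = max 0 (1 - of_nat n * infdist z C)" for n z
  have gc: "continuous_on UNIV (g n)" for n
    unfolding g_def by (intro continuous_intros)
  have gm: "g n \<in> borel_measurable circle_measure" for n
    by (intro borel_measurable_circleI borel_measurable_continuous_onI gc)
  have lim: "(\<lambda>n. g n z) \<longlonglongrightarrow> indicator C z" for z
  proof (cases "z \<in> C")
    case True
    then show ?thesis by (simp add: g_def)
  next
    case F: False
    then have d: "infdist z C > 0"
      using in_closed_iff_infdist_zero[OF C False] infdist_nonneg[of z C] by (metis less_eq_real_def)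
    obtain n0 where n0: "1 / infdist z C < of_nat n0" using reals_Archimedean2 by blast
    have "g n z = 0" if "n \<ge> n0" for n
    proof -
      have "1 / infdist z C < of_nat n" using n0 that by (meson less_le_trans of_nat_mono)
      then show ?thesis using d by (simp add: g_def field_simps)
    qed
    then show ?thesis
      using F by (intro tendsto_eventually) (auto simp: eventually_sequentially)
  qed
  have Cs [measurable]: "(indicator C :: complex \<Rightarrow> real) \<in> borel_measurable circle_measure"
    using C by (intro borel_measurable_circleI borel_measurable_indicator) auto
  have "(\<lambda>n. LINT z|circle_measure. of_real (g n z) * h z) \<longlonglongrightarrow> (LINT z|circle_measure. indicator C z *\<^sub>R h z)"
  proof (rule integral_dominated_convergence[where w = "\<lambda>z. cmod (h z)"])
    show "AE z in circle_measure. (\<lambda>n. of_real (g n z) * h z) \<longlonglongrightarrow> indicator C z *\<^sub>R h z"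
      unfolding scaleR_conv_of_real by (intro AE_I2 tendsto_intros lim)
    show "AE z in circle_measure. cmod (of_real (g n z) * h z) \<le> cmod (h z)" for n
      by (intro AE_I2) (auto simp: norm_mult g_def infdist_nonneg intro!: mult_left_le_one_le)
  qed (use hi gm Cs in auto)
  then show ?thesis
    by (simp add: fourier_null_integral_continuous[OF h gc] LIMSEQ_const_iff)
qed simp

text \<open>The Borel sets over which h integrates to 0 contain the closed sets, hence the open ones
  since the total integral is the coefficient of index 0. They are also closed under complements and
  disjoint unions, so every Borel set is among them.\<close>

theorem fourier_null_AE:
  assumes h: "fourier_null h"
  shows "AE z in circle_measure. h z = 0"
proof -
  have hi: "integrable circle_measure h" using h by (simp add: fourier_null_def)
  have ind: "integrable circle_measure (\<lambda>z. indicator A z *\<^sub>R h z)" if "A \<in> sets borel" for A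
  proof -
    have m: "(indicator A :: complex \<Rightarrow> real) \<in> borel_measurable circle_measure"
      using that by (intro borel_measurable_circleI borel_measurable_indicator) auto
    have le: "cmod (of_real (indicator A z)) \<le> 1" for z
      by (cases "z \<in> A") auto
    have "integrable circle_measure (\<lambda>z. of_real (indicator A z) * h z)"
      by (intro integrable_bounded_mult[OF hi, where B = 1] measurable_compose[OF m, of of_real borel] le) measurable
    then show ?thesis by (simp add: scaleR_conv_of_real)
  qed
  have h0: "(LINT z|circle_measure. h z) = 0"
    using h circle_exp_0 by (auto simp: fourier_null_def dest: spec[of _ 0])
  have borel: "(LINT z|circle_measure. indicator A z *\<^sub>R h z) = 0" if "A \<in> sets borel" for A
  proof -
    have "Int_stable {S :: complex set. open S}" "{S :: complex set. open S} \<subseteq> Pow UNIV"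
        "A \<in> sigma_sets UNIV {S. open S}"
      using that by (auto simp: Int_stable_def borel_def)
    then show ?thesis
    proof (induction rule: sigma_sets_induct_disjoint)
      case (basic A)
      have A: "A \<in> sets borel" using basic by auto
      have "(LINT z|circle_measure. indicator (- A) z *\<^sub>R h z) = 0"
        by (rule fourier_null_integral_closed[OF h]) (use basic in auto)
      moreover have "(LINT z|circle_measure. h z) =
          (LINT z|circle_measure. indicator A z *\<^sub>R h z + indicator (- A) z *\<^sub>R h z)"
        by (rule Bochner_Integration.integral_cong) (auto simp: indicator_def)
      ultimately show ?case
        using A h0 by (simp add: Bochner_Integration.integral_add[OF ind ind])
    next
      case empty
      then show ?case by simp
    next
      case (compl A)
      have A: "A \<in> sets borel" using compl by (simp add: borel_def)
      have "(LINT z|circle_measure. h z) =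
          (LINT z|circle_measure. indicator A z *\<^sub>R h z + indicator (UNIV - A) z *\<^sub>R h z)"
        by (rule Bochner_Integration.integral_cong) (auto simp: indicator_def)
      moreover have "UNIV - A \<in> sets borel" using A by auto
      ultimately show ?case
        using A h0 compl by (simp add: Bochner_Integration.integral_add[OF ind ind])
    next
      case (union A)
      have A: "A i \<in> sets borel" for i using union by (auto simp: borel_def)
      have sums: "(\<lambda>i. indicator (A i) z *\<^sub>R h z) sums (indicator (\<Union>i. A i) z *\<^sub>R h z)" for z
        by (intro sums_scaleR_left indicator_sums) (use union in \<open>auto simp: disjoint_family_on_def\<close>)
      have Am [measurable]: "(indicator (\<Union>i. A i) :: complex \<Rightarrow> real) \<in> borel_measurable circle_measure"
        using A by (intro borel_measurable_circleI borel_measurable_indicator) auto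
      have "(\<lambda>n. LINT z|circle_measure. (\<Sum>i<n. indicator (A i) z *\<^sub>R h z)) \<longlonglongrightarrow>
          (LINT z|circle_measure. indicator (\<Union>i. A i) z *\<^sub>R h z)"
      proof (rule integral_dominated_convergence[where w = "\<lambda>z. cmod (h z)"])
        show "AE z in circle_measure. (\<lambda>n. \<Sum>i<n. indicator (A i) z *\<^sub>R h z) \<longlonglongrightarrow> indicator (\<Union>i. A i) z *\<^sub>R h z"
          using sums by (auto simp: sums_def)
        show "AE z in circle_measure. cmod (\<Sum>i<n. indicator (A i) z *\<^sub>R h z) \<le> cmod (h z)" for n
        proof (rule AE_I2)
          fix z
          have "(\<Sum>i<n. indicator (A i) z :: real) = indicator (\<Union>i<n. A i) z"
            by (rule indicator_UN_disjoint[symmetric])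
               (use union in \<open>auto simp: disjoint_family_on_def\<close>)
          then show "cmod (\<Sum>i<n. indicator (A i) z *\<^sub>R h z) \<le> cmod (h z)"
            by (simp flip: scaleR_sum_left) (simp add: indicator_def)
        qed
        show "(\<lambda>z. \<Sum>i<n. indicator (A i) z *\<^sub>R h z) \<in> borel_measurable circle_measure" for n
          using ind[OF A] by (intro borel_measurable_sum) auto
      qed (use hi Am in auto)
      moreover have "(LINT z|circle_measure. (\<Sum>i<n. indicator (A i) z *\<^sub>R h z)) = 0" for n
        using ind[OF A] union by (subst Bochner_Integration.integral_sum) auto
      ultimately show ?case by (simp add: LIMSEQ_const_iff)
    qed
  qed
  show ?thesis
  proof (rule circle.density_zero[OF hi])
    fix A assume "A \<in> sets circle_measure"
    then have "A \<in> sets borel"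
      by (auto simp: sets_restrict_space)
    then show "set_lebesgue_integral circle_measure A h = 0"
      using borel[of A] by (simp add: set_lebesgue_integral_def)
  qed
qed

corollary L2_fourier_AE_zero:
  assumes "f \<in> L2" "\<And>n. L2_inner (circle_exp n) f = 0"
  shows "AE z in circle_measure. f z = 0"
proof (rule fourier_null_AE)
  have "(LINT z|circle_measure. circle_exp n z * f z) = L2_inner (circle_exp (- n)) f" for n
    unfolding L2_inner_def
    by (rule Bochner_Integration.integral_cong) (auto simp: cnj_circle_exp)
  then show "fourier_null f"
    using assms L2_imp_integrable by (simp add: fourier_null_def)
qed

section \<open>Loop representations\<close>

lemma L2_inner_cong:
  assumes "\<And>z. norm z = 1 \<Longrightarrow> f z = f' z" "\<And>z. norm z = 1 \<Longrightarrow> g z = g' z"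
  shows "L2_inner f g = L2_inner f' g'"
  unfolding L2_inner_def by (rule Bochner_Integration.integral_cong) (use assms in auto)

section \<open>Unitary matrices in terms of entries\<close>

lemma dim_mat_adjoint [simp]: "dim_row (mat_adjoint A) = dim_col A" "dim_col (mat_adjoint A) = dim_row A"
  by (simp_all add: mat_adjoint_def)

lemma index_mat_adjoint [simp]:
  "i < dim_col A \<Longrightarrow> j < dim_row A \<Longrightarrow> mat_adjoint A $$ (i, j) = conjugate (A $$ (j, i))"
  by (simp add: mat_adjoint_def mat_of_rows_index)

lemma index_mult_mat_sum:
  "i < dim_row A \<Longrightarrow> j < dim_col B \<Longrightarrow> dim_col A = dim_row B \<Longrightarrow>
    (A * B) $$ (i, j) = (\<Sum>k<dim_row B. A $$ (i, k) * B $$ (k, j))"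
  by (simp add: scalar_prod_def lessThan_atLeast0)

lemma unitary_group_columns:
  assumes "U \<in> unitary_group N" "i < N" "j < N"
  shows "(\<Sum>k<N. cnj (U $$ (k, i)) * U $$ (k, j)) = (if i = j then 1 else 0)"
proof -
  have U: "U \<in> carrier_mat N N" and eq: "mat_adjoint U * U = 1\<^sub>m N"
    using assms(1) by (auto simp: unitary_group_def)
  have "(mat_adjoint U * U) $$ (i, j) = (\<Sum>k<N. cnj (U $$ (k, i)) * U $$ (k, j))"
    using U assms(2,3) by (subst index_mult_mat_sum) auto
  then show ?thesis using assms(2,3) by (simp add: eq)
qed

lemma unitary_group_rows:
  assumes "U \<in> unitary_group N" "i < N" "j < N"
  shows "(\<Sum>k<N. cnj (U $$ (i, k)) * U $$ (j, k)) = (if i = j then 1 else 0)"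
proof -
  have U: "U \<in> carrier_mat N N" and eq: "U * mat_adjoint U = 1\<^sub>m N"
    using assms(1) by (auto simp: unitary_group_def)
  have "(U * mat_adjoint U) $$ (j, i) = (\<Sum>k<N. cnj (U $$ (i, k)) * U $$ (j, k))"
    using U assms(2,3) by (subst index_mult_mat_sum) (auto simp: mult.commute)
  then show ?thesis using assms(2,3) by (auto simp add: eq)
qed

lemma unitary_groupI_columns:
  assumes U: "U \<in> carrier_mat N N"
    and cols: "\<And>i j. i < N \<Longrightarrow> j < N \<Longrightarrow>
      (\<Sum>k<N. cnj (U $$ (k, i)) * U $$ (k, j)) = (if i = j then 1 else 0)"
  shows "U \<in> unitary_group N"
proof -
  have adj: "mat_adjoint U \<in> carrier_mat N N" using U by auto
  have "mat_adjoint U * U = 1\<^sub>m N"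
  proof (rule eq_matI)
    fix i j assume "i < dim_row (1\<^sub>m N)" "j < dim_col (1\<^sub>m N)"
    then have ij: "i < N" "j < N" by auto
    have "(mat_adjoint U * U) $$ (i, j) = (\<Sum>k<N. cnj (U $$ (k, i)) * U $$ (k, j))"
      using U ij by (subst index_mult_mat_sum) auto
    then show "(mat_adjoint U * U) $$ (i, j) = 1\<^sub>m N $$ (i, j)"
      using cols ij by simp
  qed (use U in auto)
  with mat_mult_left_right_inverse[OF adj U] U show ?thesis
    by (simp add: unitary_group_def)
qed

text \<open>The isometry relations, the adjoints and the reducibility criterion need only a
  measurable unitary loop; the genus two form enters later.\<close>

locale unitary_loop =
  fixes N :: nat and A :: "complex \<Rightarrow> complex mat"
  assumes N_pos: "N > 0"
    and unitary: "norm z = 1 \<Longrightarrow> A z \<in> unitary_group N"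
    and measurable_entries: "i < N \<Longrightarrow> j < N \<Longrightarrow> (\<lambda>z. A z $$ (i, j)) \<in> borel_measurable circle_measure"
begin

abbreviation "T \<equiv> loop_rep N A"

lemma norm_entry_le:
  assumes "norm z = 1" "i < N" "j < N" shows "norm (A z $$ (i, j)) \<le> 1"
proof -
  have "(\<Sum>k<N. (cmod (A z $$ (i, k)))\<^sup>2) = 1"
  proof -
    have "complex_of_real (\<Sum>k<N. (cmod (A z $$ (i, k)))\<^sup>2) = (\<Sum>k<N. cnj (A z $$ (i, k)) * A z $$ (i, k))"
      by (simp only: of_real_sum complex_norm_square mult.commute)
    also have "\<dots> = of_real 1" using unitary_group_rows[OF unitary, of z i i] assms by simp
    finally show ?thesis by (simp only: of_real_eq_iff)
  qed
  moreover have "(cmod (A z $$ (i, j)))\<^sup>2 \<le> (\<Sum>k<N. (cmod (A z $$ (i, k)))\<^sup>2)"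
    by (rule member_le_sum) (use assms in auto)
  ultimately show ?thesis by (simp add: power_le_one_iff)
qed

lemma measurable_entry_power:
  "i < N \<Longrightarrow> j < N \<Longrightarrow> (\<lambda>z. A (z ^ N) $$ (i, j)) \<in> borel_measurable circle_measure"
  by (rule measurable_compose[OF measurable_power_circle measurable_entries])

lemma measurable_filter:
  assumes "i < N" shows "loop_filter N A i \<in> borel_measurable circle_measure"
proof -
  have "(\<lambda>z. z ^ j) \<in> borel_measurable circle_measure" for j
    by (rule borel_measurable_circleI) measurable
  then have "(\<lambda>z. \<Sum>j<N. z ^ j * (A (z ^ N) $$ (i, j))) \<in> borel_measurable circle_measure"
    using assms by (intro borel_measurable_sum borel_measurable_times measurable_entry_power) auto
  then show ?thesis by (simp add: loop_filter_def[abs_def])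
qed

lemma norm_filter_le:
  assumes "i < N" "norm z = 1" shows "norm (loop_filter N A i z) \<le> N"
proof -
  have "norm (z ^ j * (A (z ^ N) $$ (i, j))) \<le> 1" if "j < N" for j
    using norm_entry_le[of "z ^ N" i j] assms that by (simp add: norm_mult norm_power)
  then have "norm (loop_filter N A i z) \<le> (\<Sum>j<N. 1)"
    unfolding loop_filter_def by (intro sum_norm_le) auto
  then show ?thesis by simp
qed

lemma loop_rep_L2: "i < N \<Longrightarrow> \<xi> \<in> L2 \<Longrightarrow> T i \<xi> \<in> L2"
  unfolding loop_rep_def
  by (rule L2_bounded_mult[where B = "real N"])
     (auto intro: L2_compose_power N_pos measurable_filter norm_filter_le)

text \<open>The Cuntz relation for the isometries in weak form. In the product of two filters the
  exponents differ by less than N, so only equal exponents survive integration, and the rows of A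
  are orthonormal.\<close>

lemma L2_inner_loop_rep:
  assumes il: "i < N" "l < N" and L2: "\<xi> \<in> L2" "\<eta> \<in> L2"
  shows "L2_inner (T i \<xi>) (T l \<eta>) = (if i = l then L2_inner \<xi> \<eta> else 0)"
proof -
  \<comment> \<open>Collects everything that depends on z only through z^N.\<close>
  define h where "h p q w = (cnj (A w $$ (i, p)) * A w $$ (l, q)) * (cnj (\<xi> w) * \<eta> w)" for p q w
  have hi: "integrable circle_measure (h p q)" if "p < N" "q < N" for p q
    unfolding h_def
  proof (rule integrable_bounded_mult[where B = 1])
    show "integrable circle_measure (\<lambda>w. cnj (\<xi> w) * \<eta> w)" by (rule L2_inner_integrable[OF L2])
    show "(\<lambda>w. cnj (A w $$ (i, p)) * A w $$ (l, q)) \<in> borel_measurable circle_measure"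
      using il that
      by (intro borel_measurable_times measurable_entries measurable_compose[OF measurable_entries measurable_cnj]) auto
    show "norm (cnj (A w $$ (i, p)) * A w $$ (l, q)) \<le> 1" if "norm w = 1" for w
      using that il \<open>p < N\<close> \<open>q < N\<close> by (auto simp: norm_mult intro!: mult_le_one norm_entry_le)
  qed
  have hpi: "integrable circle_measure (\<lambda>z. circle_exp r z * h p q (z ^ N))" if "p < N" "q < N" for p q r
    by (intro integrable_circle_exp_mult integrable_compose_power N_pos hi that)
  have "L2_inner (T i \<xi>) (T l \<eta>) =
      (LINT z|circle_measure. (\<Sum>p<N. \<Sum>q<N. circle_exp (int q - int p) z * h p q (z ^ N)))"
    unfolding L2_inner_def
  proof (rule Bochner_Integration.integral_cong[OF refl])
    fix z assume "z \<in> space circle_measure"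
    then have z: "norm z = 1" by simp
    have e: "circle_exp (int q - int p) z = cnj (z ^ p) * z ^ q" for p q
    proof -
      have "circle_exp (int q - int p) z = circle_exp (int q) z * circle_exp (- int p) z"
        using circle_exp_add[OF z, of "int q" "- int p"] by simp
      also have "circle_exp (- int p) z = cnj (z ^ p)"
        by (simp only: cnj_circle_exp[OF z, symmetric] circle_exp_of_nat)
      finally show ?thesis by (simp add: circle_exp_of_nat mult.commute)
    qed
    have "cnj (T i \<xi> z) * T l \<eta> z = (cnj (loop_filter N A i z) * loop_filter N A l z) * (cnj (\<xi> (z ^ N)) * \<eta> (z ^ N))"
      by (simp add: loop_rep_def)
    also have "cnj (loop_filter N A i z) * loop_filter N A l z =
        (\<Sum>p<N. \<Sum>q<N. cnj (z ^ p * A (z ^ N) $$ (i, p)) * (z ^ q * A (z ^ N) $$ (l, q)))"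
      by (simp only: loop_filter_def cnj_sum sum_product)
    finally have prod: "cnj (T i \<xi> z) * T l \<eta> z = (\<Sum>p<N. \<Sum>q<N. cnj (z ^ p * A (z ^ N) $$ (i, p)) *
        (z ^ q * A (z ^ N) $$ (l, q))) * (cnj (\<xi> (z ^ N)) * \<eta> (z ^ N))" .
    show "cnj (T i \<xi> z) * T l \<eta> z = (\<Sum>p<N. \<Sum>q<N. circle_exp (int q - int p) z * h p q (z ^ N))"
      unfolding prod sum_distrib_right by (intro sum.cong refl) (simp add: h_def e mult_ac)
  qed
  also have "\<dots> = (\<Sum>p<N. LINT z|circle_measure. (\<Sum>q<N. circle_exp (int q - int p) z * h p q (z ^ N)))"
    by (rule Bochner_Integration.integral_sum) (auto intro!: Bochner_Integration.integrable_sum hpi)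
  also have "\<dots> = (\<Sum>p<N. \<Sum>q<N. LINT z|circle_measure. circle_exp (int q - int p) z * h p q (z ^ N))"
    by (intro sum.cong refl Bochner_Integration.integral_sum hpi) auto
  also have "\<dots> = (\<Sum>p<N. \<Sum>q<N. if q = p then LINT w|circle_measure. h p q w else 0)"
    by (intro sum.cong refl, subst integral_circle_exp_mult_compose_power) (auto intro: hi)
  also have "\<dots> = (\<Sum>p<N. LINT w|circle_measure. h p p w)"
    by simp
  also have "\<dots> = (LINT w|circle_measure. (\<Sum>p<N. h p p w))"
    by (rule Bochner_Integration.integral_sum[symmetric]) (auto intro: hi)
  also have "\<dots> = (LINT w|circle_measure. (if i = l then 1 else 0) * (cnj (\<xi> w) * \<eta> w))"
  proof (rule Bochner_Integration.integral_cong[OF refl])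
    fix w assume "w \<in> space circle_measure"
    then show "(\<Sum>p<N. h p p w) = (if i = l then 1 else 0) * (cnj (\<xi> w) * \<eta> w)"
      by (simp only: h_def sum_distrib_right[symmetric] unitary_group_rows[OF unitary il] norm_circle)
  qed
  also have "\<dots> = (if i = l then L2_inner \<xi> \<eta> else 0)"
    by (simp add: L2_inner_def)
  finally show ?thesis .
qed

text \<open>The filters form the vector A(z^N) (1, z, ..., z^(N-1)), so the adjoint of A(z^N)
  recovers the monomials. This takes the place of the completeness relation of the Cuntz
  algebra.\<close>

lemma sum_filter_mult_cnj_entry:
  assumes z: "norm z = 1" and j: "j < N"
  shows "(\<Sum>i<N. loop_filter N A i z * cnj (A (z ^ N) $$ (i, j))) = z ^ j"
proof -
  have zN: "norm (z ^ N) = 1" using z by (simp add: norm_power)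
  have "(\<Sum>i<N. loop_filter N A i z * cnj (A (z ^ N) $$ (i, j))) =
      (\<Sum>i<N. \<Sum>p<N. z ^ p * (cnj (A (z ^ N) $$ (i, j)) * A (z ^ N) $$ (i, p)))"
    unfolding loop_filter_def sum_distrib_right by (simp add: mult_ac)
  also have "\<dots> = (\<Sum>p<N. z ^ p * (\<Sum>i<N. cnj (A (z ^ N) $$ (i, j)) * A (z ^ N) $$ (i, p)))"
    by (subst sum.swap) (simp add: sum_distrib_left)
  also have "\<dots> = (\<Sum>p<N. if j = p then z ^ p else 0)"
    by (rule sum.cong) (auto simp: unitary_group_columns[OF unitary[OF zN] j])
  also have "\<dots> = z ^ j" using j by simp
  finally show ?thesis .
qed

text \<open>The adjoint of \<open>T i\<close> averages over the \<open>N\<close>-th roots, so the choice in \<^const>\<open>L2_adjoint\<close> is over a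
  nonempty set.\<close>

lemma L2_adjoint_exists:
  assumes i: "i < N"
  shows "\<exists>S. \<forall>\<eta>\<in>L2. S \<eta> \<in> L2 \<and> (\<forall>\<xi>\<in>L2. L2_inner (T i \<xi>) \<eta> = L2_inner \<xi> (S \<eta>))"
proof -
  define G where "G \<eta> z = cnj (loop_filter N A i z) * \<eta> z" for \<eta> z
  define S where "S \<eta> w = of_real (1 / N) * (\<Sum>k<N. G \<eta> (circle_root N k w))" for \<eta> w
  have G: "G \<eta> \<in> L2" if "\<eta> \<in> L2" for \<eta>
    unfolding G_def
    by (rule L2_bounded_mult[where B = "real N", OF that])
       (use i in \<open>auto intro: norm_filter_le measurable_compose[OF measurable_filter measurable_cnj]\<close>)
  have GL: "(\<lambda>w. G \<eta> (circle_root N k w)) \<in> L2" if "\<eta> \<in> L2" "k < N" for \<eta> k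
    using G[OF that(1)] integrable_circle_root[OF N_pos, of "\<lambda>z. (cmod (G \<eta> z))\<^sup>2" k] that(2)
      measurable_compose[OF measurable_circle_root] by (auto simp: L2_def)
  have SL: "S \<eta> \<in> L2" if "\<eta> \<in> L2" for \<eta>
    unfolding S_def using GL[OF that] by (intro L2_cmult L2_sum) auto
  have "L2_inner (T i \<xi>) \<eta> = L2_inner \<xi> (S \<eta>)" if L2: "\<xi> \<in> L2" "\<eta> \<in> L2" for \<xi> \<eta>
  proof -
    have eq: "cnj (T i \<xi> z) * \<eta> z = cnj (\<xi> (z ^ N)) * G \<eta> z" for z
      by (simp add: loop_rep_def G_def)
    have int: "integrable circle_measure (\<lambda>z. cnj (\<xi> (z ^ N)) * G \<eta> z)"
      using L2_inner_integrable[OF loop_rep_L2[OF i L2(1)] L2(2)] by (simp only: eq)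
    have "L2_inner (T i \<xi>) \<eta> = (1 / N) *\<^sub>R (\<Sum>k<N. LINT w|circle_measure.
        cnj (\<xi> (circle_root N k w ^ N)) * G \<eta> (circle_root N k w))"
      unfolding L2_inner_def eq by (rule integral_circle_root[OF N_pos int])
    also have "(\<Sum>k<N. LINT w|circle_measure. cnj (\<xi> (circle_root N k w ^ N)) * G \<eta> (circle_root N k w)) =
        (\<Sum>k<N. L2_inner \<xi> (\<lambda>w. G \<eta> (circle_root N k w)))"
      unfolding L2_inner_def
      by (intro sum.cong Bochner_Integration.integral_cong) (auto simp: circle_root_power N_pos)
    also have "\<dots> = L2_inner \<xi> (\<lambda>w. \<Sum>k<N. G \<eta> (circle_root N k w))"
      by (rule L2_inner_sum_right[symmetric]) (use L2 GL in auto)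
    also have "(1 / N) *\<^sub>R \<dots> = L2_inner \<xi> (S \<eta>)"
      unfolding S_def L2_inner_cmult_right by (simp only: scaleR_conv_of_real)
    finally show ?thesis .
  qed
  with SL show ?thesis by blast
qed

lemma
  assumes "i < N" "\<eta> \<in> L2"
  shows L2_adjoint_L2: "L2_adjoint (T i) \<eta> \<in> L2"
    and L2_inner_adjoint: "\<xi> \<in> L2 \<Longrightarrow> L2_inner (T i \<xi>) \<eta> = L2_inner \<xi> (L2_adjoint (T i) \<eta>)"
  using someI_ex[OF L2_adjoint_exists[OF assms(1)]] assms(2) unfolding L2_adjoint_def by blast+

text \<open>Words in the generators alone, without adjoints: from a common eigenvector of the
  adjoints, applying an adjoint to such a word only shortens or rescales it, or gives 0.\<close>

inductive_set orbit :: "(complex \<Rightarrow> complex) \<Rightarrow> (complex \<Rightarrow> complex) set" for v where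
  base: "v \<in> orbit v"
| step: "g \<in> orbit v \<Longrightarrow> i < N \<Longrightarrow> T i g \<in> orbit v"

lemma orbit_L2: "g \<in> orbit v \<Longrightarrow> v \<in> L2 \<Longrightarrow> g \<in> L2"
  by (induction rule: orbit.induct) (auto intro: loop_rep_L2)

end

section \<open>Reducibility from a common eigenvector of the adjoints\<close>

lemma closed_subspace_annihilator:
  assumes S: "S \<subseteq> L2"
  shows "closed_subspace {f \<in> L2. \<forall>g\<in>S. L2_inner g f = 0}"
  unfolding closed_subspace_def
proof (intro conjI allI impI ballI)
  fix F :: "nat \<Rightarrow> complex \<Rightarrow> complex" and f
  assume F: "\<forall>n. F n \<in> {f \<in> L2. \<forall>g\<in>S. L2_inner g f = 0}" and f: "f \<in> L2"
    and lim: "(\<lambda>n. L2_norm (\<lambda>z. F n z - f z)) \<longlonglongrightarrow> 0"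
  have "L2_inner g f = 0" if g: "g \<in> S" for g
  proof -
    have gL: "g \<in> L2" using g S by blast
    have le: "cmod (L2_inner g f) \<le> L2_norm g * L2_norm (\<lambda>z. F n z - f z)" for n
    proof -
      have Fn: "F n \<in> L2" "L2_inner g (F n) = 0" using F g by auto
      have "cmod (L2_inner g (\<lambda>z. F n z - f z)) \<le> L2_norm g * L2_norm (\<lambda>z. F n z - f z)"
        by (intro L2_Cauchy_Schwarz gL L2_diff Fn f)
      then show ?thesis
        by (simp add: L2_inner_diff_right[OF gL Fn(1) f] Fn(2))
    qed
    have "(\<lambda>n. L2_norm g * L2_norm (\<lambda>z. F n z - f z)) \<longlonglongrightarrow> L2_norm g * 0"
      by (intro tendsto_mult tendsto_const lim)
    then have "cmod (L2_inner g f) \<le> L2_norm g * 0"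
      by (rule tendsto_lowerbound) (simp_all add: le always_eventually)
    then show ?thesis by simp
  qed
  with f show "f \<in> {f \<in> L2. \<forall>g\<in>S. L2_inner g f = 0}" by blast
qed (use S in \<open>auto simp: L2_inner_add_right L2_inner_cmult_right subset_iff\<close>)

context unitary_loop
begin

text \<open>The hypothesis \<open>eig\<close> says weakly that the adjoint of each
  \<open>T i\<close> maps v to \<open>c i\<close> times v, without mention of the chosen adjoint.
  The reducing subspace is the annihilator of the orbit, closed by construction: v keeps it from
  being everything, and u keeps it from being null.\<close>

lemma reducible_if_coinvariant_vector:
  assumes v: "v \<in> L2" "L2_inner v v \<noteq> 0"
    and eig: "\<And>i \<xi>. i < N \<Longrightarrow> \<xi> \<in> L2 \<Longrightarrow> L2_inner (T i \<xi>) v = c i * L2_inner \<xi> v"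
    and u: "u \<in> L2" "L2_inner u u \<noteq> 0" and ann: "\<And>g. g \<in> orbit v \<Longrightarrow> L2_inner g u = 0"
  shows "reducible_rep N T"
proof -
  define M where "M = {f \<in> L2. \<forall>g\<in>orbit v. L2_inner g f = 0}"
  have orb: "orbit v \<subseteq> L2" using orbit_L2 v by blast
  have M: "closed_subspace M" unfolding M_def by (rule closed_subspace_annihilator[OF orb])
  have "T i f \<in> M \<and> L2_adjoint (T i) f \<in> M" if i: "i < N" and f: "f \<in> M" for i f
  proof
    have fL: "f \<in> L2" and f0: "\<And>g. g \<in> orbit v \<Longrightarrow> L2_inner g f = 0"
      using f by (auto simp: M_def)
    have "L2_inner g (T i f) = 0" if "g \<in> orbit v" for g
      using that
    proof cases
      case base
      have "L2_inner f v = 0"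
        by (subst L2_inner_commute) (simp add: f0 orbit.base)
      then show ?thesis
        unfolding base by (subst L2_inner_commute) (simp add: eig[OF i fL])
    next
      \<comment> \<open>Pairing \<open>T j g'\<close> with \<open>T i f\<close> leaves the pairing
        of \<open>g'\<close> with \<open>f\<close>, or 0.\<close>
      case (step g' j)
      then show ?thesis
        using L2_inner_loop_rep[OF step(3) i _ fL, of g'] orb by (auto simp: f0)
    qed
    then show "T i f \<in> M" using loop_rep_L2[OF i fL] by (simp add: M_def)
    have "L2_inner g (L2_adjoint (T i) f) = 0" if "g \<in> orbit v" for g
      using L2_inner_adjoint[OF i fL, of g] that orb f0[OF orbit.step[OF that i]] by auto
    then show "L2_adjoint (T i) f \<in> M" using L2_adjoint_L2[OF i fL] by (simp add: M_def)
  qed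
  moreover have "v \<notin> M" using v orbit.base[of v] by (auto simp: M_def)
  then have "M \<noteq> L2" using v by blast
  moreover have "M \<noteq> L2_null"
  proof
    assume "M = L2_null"
    then have "u \<in> L2_null" using u ann by (auto simp: M_def)
    then have "L2_inner u u = (LINT z|circle_measure. 0)"
      unfolding L2_inner_def
      by (intro integral_cong_AE) (auto simp: L2_null_def intro!: borel_measurable_integrable[OF L2_inner_integrable])
    with u show False by simp
  qed
  ultimately show ?thesis
    using M unfolding reducible_rep_def irreducible_rep_def by blast
qed

end

section \<open>Loops of genus two\<close>

locale genus_two_loop =
  fixes N :: nat and V Q :: "complex mat" and A :: "complex \<Rightarrow> complex mat"
  assumes N_gt: "N > 2"
    and V: "V \<in> unitary_group N"
    and Q: "Q \<in> orthogonal_projections N"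
    and A_eq: "A = (\<lambda>z. V * (1\<^sub>m N - Q + z \<cdot>\<^sub>m Q))"
begin

lemma carriers: "V \<in> carrier_mat N N" "Q \<in> carrier_mat N N"
  using V Q by (auto simp: unitary_group_def orthogonal_projections_def)

lemma dims [simp]: "dim_row V = N" "dim_col V = N" "dim_row Q = N" "dim_col Q = N"
  using carriers by auto

text \<open>\<open>C\<close> is V (1 - Q) and \<open>D\<close> below is V Q: the coefficients of 1
  and z in A(z).\<close>

definition C :: "nat \<Rightarrow> nat \<Rightarrow> complex" where
  "C i j = (\<Sum>k<N. V $$ (i, k) * ((if k = j then 1 else 0) - Q $$ (k, j)))"

definition D :: "nat \<Rightarrow> nat \<Rightarrow> complex" where
  "D i j = (\<Sum>k<N. V $$ (i, k) * Q $$ (k, j))"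

lemma entry: "i < N \<Longrightarrow> j < N \<Longrightarrow> A z $$ (i, j) = C i j + z * D i j"
  unfolding A_eq
  by (subst index_mult_mat_sum) (auto simp: C_def D_def sum_distrib_left algebra_simps simp flip: sum.distrib)

lemma Q_cnj: "i < N \<Longrightarrow> j < N \<Longrightarrow> cnj (Q $$ (i, j)) = Q $$ (j, i)"
proof -
  assume ij: "i < N" "j < N"
  have "mat_adjoint Q = Q" using Q by (simp add: orthogonal_projections_def)
  then have "mat_adjoint Q $$ (j, i) = Q $$ (j, i)" by simp
  then show ?thesis using ij by simp
qed

lemma Q_idem: "i < N \<Longrightarrow> j < N \<Longrightarrow> (\<Sum>k<N. Q $$ (i, k) * Q $$ (k, j)) = Q $$ (i, j)"
proof -
  assume ij: "i < N" "j < N"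
  have "Q * Q = Q" using Q by (simp add: orthogonal_projections_def)
  then have "(Q * Q) $$ (i, j) = Q $$ (i, j)" by simp
  then show ?thesis using ij by (subst (asm) index_mult_mat_sum) auto
qed

text \<open>V preserves inner products; through this lemma it disappears from all later
  identities.\<close>

lemma sum_V:
  "(\<Sum>i<N. cnj (\<Sum>k<N. V $$ (i, k) * f k) * (\<Sum>k<N. V $$ (i, k) * g k)) = (\<Sum>k<N. cnj (f k) * g k)"
proof -
  have "(\<Sum>i<N. cnj (\<Sum>k<N. V $$ (i, k) * f k) * (\<Sum>k<N. V $$ (i, k) * g k)) =
      (\<Sum>i<N. \<Sum>k<N. \<Sum>l<N. (cnj (V $$ (i, k)) * V $$ (i, l)) * (cnj (f k) * g l))"
    unfolding cnj_sum sum_product by (simp add: mult_ac)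
  also have "\<dots> = (\<Sum>k<N. \<Sum>l<N. (\<Sum>i<N. cnj (V $$ (i, k)) * V $$ (i, l)) * (cnj (f k) * g l))"
    unfolding sum_distrib_right by (subst sum.swap, subst (2) sum.swap) (rule refl)
  also have "\<dots> = (\<Sum>k<N. \<Sum>l<N. if k = l then cnj (f k) * g l else 0)"
    by (intro sum.cong refl) (auto simp: unitary_group_columns[OF V])
  also have "\<dots> = (\<Sum>k<N. cnj (f k) * g k)"
    by simp
  finally show ?thesis .
qed

abbreviation E :: "nat \<Rightarrow> nat \<Rightarrow> complex" where
  "E i j \<equiv> (if i = j then 1 else 0) - Q $$ (i, j)"

lemma E_cnj: "i < N \<Longrightarrow> j < N \<Longrightarrow> cnj (E i j) = E j i"
  by (auto simp: Q_cnj)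

lemma EQ: "i < N \<Longrightarrow> j < N \<Longrightarrow> (\<Sum>k<N. E i k * Q $$ (k, j)) = 0"
  by (simp add: left_diff_distrib sum_subtractf Q_idem if_distrib[of "\<lambda>x. x * _"] cong: if_cong)

lemma EE: "i < N \<Longrightarrow> j < N \<Longrightarrow> (\<Sum>k<N. E i k * E k j) = E i j"
proof -
  assume ij: "i < N" "j < N"
  have "(\<Sum>k<N. E i k * E k j) = (\<Sum>k<N. E i k * (if k = j then 1 else 0)) - (\<Sum>k<N. E i k * Q $$ (k, j))"
    by (simp only: right_diff_distrib sum_subtractf)
  also have "\<dots> = E i j"
    using ij by (simp only: EQ) (simp add: if_distrib[of "\<lambda>x. _ * x"] cong: if_cong)
  finally show ?thesis .
qed

text \<open>With V gone, the four products are (1 - Q)(1 - Q), (1 - Q) Q, Q (1 - Q) and Q Q.\<close>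

lemma
  assumes ij: "i < N" "j < N"
  shows sum_CC: "(\<Sum>l<N. cnj (C l i) * C l j) = E i j"
    and sum_CD: "(\<Sum>l<N. cnj (C l i) * D l j) = 0"
    and sum_DC: "(\<Sum>l<N. cnj (D l i) * C l j) = 0"
    and sum_DD: "(\<Sum>l<N. cnj (D l i) * D l j) = Q $$ (i, j)"
proof -
  show "(\<Sum>l<N. cnj (C l i) * C l j) = E i j"
    unfolding C_def sum_V EE[OF ij, symmetric] by (intro sum.cong refl) (simp only: E_cnj ij lessThan_iff)
  have CD: "(\<Sum>l<N. cnj (C l i) * D l j) = 0" if "i < N" "j < N" for i j
  proof -
    have "(\<Sum>l<N. cnj (C l i) * D l j) = (\<Sum>k<N. E i k * Q $$ (k, j))"
      unfolding C_def D_def sum_V by (intro sum.cong refl) (simp only: E_cnj that lessThan_iff)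
    then show ?thesis by (simp only: EQ that)
  qed
  show "(\<Sum>l<N. cnj (C l i) * D l j) = 0" by (rule CD[OF ij])
  show "(\<Sum>l<N. cnj (D l i) * D l j) = Q $$ (i, j)"
    unfolding D_def sum_V Q_idem[OF ij, symmetric] by (intro sum.cong refl) (simp only: Q_cnj ij lessThan_iff)
  show "(\<Sum>l<N. cnj (D l i) * C l j) = 0"
    using arg_cong[OF CD[OF ij(2,1)], of cnj] by (simp add: mult.commute)
qed

sublocale unitary_loop N A
proof
  show "N > 0" using N_gt by simp
  show "A z \<in> unitary_group N" if z: "norm z = 1" for z
  proof (rule unitary_groupI_columns)
    show "A z \<in> carrier_mat N N" by (auto simp: A_eq)
    fix i j assume ij: "i < N" "j < N"
    have zz: "cnj z * z = 1" using z by (simp add: complex_norm_square[symmetric] mult.commute)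
    have "(\<Sum>k<N. cnj (A z $$ (k, i)) * A z $$ (k, j)) =
        (\<Sum>k<N. cnj (C k i) * C k j + z * (cnj (C k i) * D k j) + cnj z * (cnj (D k i) * C k j) +
          (cnj z * z) * (cnj (D k i) * D k j))"
      by (intro sum.cong refl) (simp add: entry ij algebra_simps)
    also have "\<dots> = (\<Sum>k<N. cnj (C k i) * C k j) + z * (\<Sum>k<N. cnj (C k i) * D k j) +
        cnj z * (\<Sum>k<N. cnj (D k i) * C k j) + (cnj z * z) * (\<Sum>k<N. cnj (D k i) * D k j)"
      by (simp only: sum.distrib sum_distrib_left)
    also have "\<dots> = (if i = j then 1 else 0)"
      by (simp only: sum_CC sum_CD sum_DC sum_DD ij zz) simp
    finally show "(\<Sum>k<N. cnj (A z $$ (k, i)) * A z $$ (k, j)) = (if i = j then 1 else 0)" .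
  qed
  show "(\<lambda>z. A z $$ (i, j)) \<in> borel_measurable circle_measure" if "i < N" "j < N" for i j
    unfolding entry[OF that] by (intro borel_measurable_circleI) measurable
qed

text \<open>\<open>sum_filter_mult_cnj_entry\<close> multiplied by the m-th exponential at z^N. The
  conjugate of A(z^N) contributes \<open>cnj (D i j)\<close> with the conjugate of z^N, which lowers
  m by one.\<close>

lemma circle_exp_decomposition:
  assumes z: "norm z = 1" and j: "j < N"
  shows "circle_exp (int j + int N * m) z =
    (\<Sum>i<N. cnj (C i j) * T i (circle_exp m) z + cnj (D i j) * T i (circle_exp (m - 1)) z)"
proof -
  have zN: "norm (z ^ N) = 1" using z by (simp add: norm_power)
  have e: "circle_exp (m - 1) (z ^ N) = circle_exp m (z ^ N) * cnj (z ^ N)"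
    using circle_exp_add[OF zN, of m "-1"] cnj_circle_exp[OF zN, of 1] by (simp add: circle_exp_def)
  have "(\<Sum>i<N. cnj (C i j) * T i (circle_exp m) z + cnj (D i j) * T i (circle_exp (m - 1)) z) =
      (\<Sum>i<N. circle_exp m (z ^ N) * (loop_filter N A i z * cnj (A (z ^ N) $$ (i, j))))"
    by (intro sum.cong refl) (simp add: loop_rep_def e entry j algebra_simps)
  also have "\<dots> = circle_exp m (z ^ N) * z ^ j"
    by (simp only: sum_distrib_left[symmetric] sum_filter_mult_cnj_entry[OF z j])
  also have "\<dots> = circle_exp (int j + int N * m) z"
    by (simp add: circle_exp_add[OF z] circle_exp_power circle_exp_of_nat)
  finally show ?thesis by simp
qed

lemma L2_inner_circle_exp_right:
  assumes f: "f \<in> L2" and j: "j < N"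
  shows "L2_inner f (circle_exp (int j + int N * m)) =
    (\<Sum>i<N. cnj (C i j) * L2_inner f (T i (circle_exp m)) + cnj (D i j) * L2_inner f (T i (circle_exp (m - 1))))"
proof -
  have "L2_inner f (circle_exp (int j + int N * m)) = L2_inner f (\<lambda>z. \<Sum>i<N. cnj (C i j) * T i (circle_exp m) z +
      cnj (D i j) * T i (circle_exp (m - 1)) z)"
    by (rule L2_inner_cong) (simp_all add: circle_exp_decomposition j)
  also have "\<dots> = (\<Sum>i<N. L2_inner f (\<lambda>z. cnj (C i j) * T i (circle_exp m) z +
      cnj (D i j) * T i (circle_exp (m - 1)) z))"
    by (rule L2_inner_sum_right[OF f]) (intro L2_add L2_cmult loop_rep_L2 circle_exp_L2, auto)
  also have "\<dots> = (\<Sum>i<N. cnj (C i j) * L2_inner f (T i (circle_exp m)) +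
      cnj (D i j) * L2_inner f (T i (circle_exp (m - 1))))"
    by (intro sum.cong refl) (simp add: L2_inner_add_right f L2_cmult loop_rep_L2 L2_inner_cmult_right)
  finally show ?thesis .
qed

text \<open>The weak form of the action of the adjoint of \<open>T i\<close> on basis vectors: index
  j + N m goes to m with weight \<open>cnj (C i j)\<close> and to m - 1 with weight
  \<open>cnj (D i j)\<close>.\<close>

lemma L2_inner_loop_rep_circle_exp:
  assumes f: "f \<in> L2" and i: "i < N" and j: "j < N"
  shows "L2_inner (T i f) (circle_exp (int j + int N * m)) =
    cnj (C i j) * L2_inner f (circle_exp m) + cnj (D i j) * L2_inner f (circle_exp (m - 1))"
proof -
  have "L2_inner (T i f) (circle_exp (int j + int N * m)) = (\<Sum>l<N. if i = l then
      cnj (C i j) * L2_inner f (circle_exp m) + cnj (D i j) * L2_inner f (circle_exp (m - 1)) else 0)"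
    unfolding L2_inner_circle_exp_right[OF loop_rep_L2[OF i f] j]
    by (intro sum.cong refl) (auto simp: L2_inner_loop_rep i f)
  then show ?thesis using i by simp
qed

text \<open>The critical indices are 0 = 0 + N 0, -1 = (N - 1) + N (-1) and -2 = (N - 2) + N (-1),
  which explains the entries of Q in the two conditions.\<close>

lemma
  assumes f: "f \<in> L2" and i: "i < N"
  shows L2_inner_loop_rep_exp_0: "L2_inner (T i f) (circle_exp 0) =
      cnj (C i 0) * L2_inner f (circle_exp 0) + cnj (D i 0) * L2_inner f (circle_exp (-1))"
    and L2_inner_loop_rep_exp_m1: "L2_inner (T i f) (circle_exp (-1)) =
      cnj (C i (N - 1)) * L2_inner f (circle_exp (-1)) + cnj (D i (N - 1)) * L2_inner f (circle_exp (-2))"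
    and L2_inner_loop_rep_exp_m2: "L2_inner (T i f) (circle_exp (-2)) =
      cnj (C i (N - 2)) * L2_inner f (circle_exp (-1)) + cnj (D i (N - 2)) * L2_inner f (circle_exp (-2))"
  using L2_inner_loop_rep_circle_exp[OF f i, of 0 0] L2_inner_loop_rep_circle_exp[OF f i, of "N - 1" "-1"]
    L2_inner_loop_rep_circle_exp[OF f i, of "N - 2" "-1"] N_gt
  by (simp_all add: of_nat_diff)

text \<open>Since Q is the square of a hermitian matrix, a diagonal entry is the squared norm of its
  column. Hence a zero on the diagonal kills the whole column.\<close>

lemma Q_diag_column: "j < N \<Longrightarrow> of_real (\<Sum>k<N. (cmod (Q $$ (k, j)))\<^sup>2) = Q $$ (j, j)"
proof -
  assume j: "j < N"
  have "complex_of_real (\<Sum>k<N. (cmod (Q $$ (k, j)))\<^sup>2) = (\<Sum>k<N. Q $$ (j, k) * Q $$ (k, j))"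
    unfolding of_real_sum complex_norm_square
    by (intro sum.cong refl) (simp add: Q_cnj j mult.commute)
  then show ?thesis by (simp add: Q_idem j)
qed

lemma Q_column_zero: "j < N \<Longrightarrow> Q $$ (j, j) = 0 \<Longrightarrow> k < N \<Longrightarrow> Q $$ (k, j) = 0"
  using Q_diag_column[of j] by (auto simp: sum_nonneg_eq_0_iff simp flip: of_real_sum)

text \<open>The same column argument for the complementary projection 1 - Q.\<close>

lemma E_column_zero:
  assumes j: "j < N" and Qj: "Q $$ (j, j) = 1" and k: "k < N"
  shows "E k j = 0"
proof -
  have "complex_of_real (\<Sum>k<N. (cmod (E k j))\<^sup>2) = (\<Sum>k<N. E j k * E k j)"
    unfolding of_real_sum complex_norm_square
    by (intro sum.cong refl) (simp only: E_cnj j lessThan_iff mult.commute)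
  also have "\<dots> = 0" using EE[OF j j] Qj by simp
  finally have "(\<Sum>k<N. (cmod (E k j))\<^sup>2) = 0" by (simp only: of_real_eq_0_iff)
  then have "(cmod (E k j))\<^sup>2 = 0" using k by (subst (asm) sum_nonneg_eq_0_iff) auto
  then show ?thesis by simp
qed

lemma reducible_a:
  assumes "Q $$ (0, 0) = 0"
  shows "reducible_rep N T"
proof -
  have "D i 0 = 0" for i
    unfolding D_def using N_gt by (intro sum.neutral) (auto simp: Q_column_zero assms)
  then have eig: "L2_inner (T i f) (circle_exp 0) = cnj (C i 0) * L2_inner f (circle_exp 0)" if "i < N" "f \<in> L2" for i f
    using L2_inner_loop_rep_exp_0[OF that(2,1)] by simp
  \<comment> \<open>Both indices are carried along because the adjoints mix -1 and -2 with each
    other, but with nothing else.\<close>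
  have "L2_inner g (circle_exp (-1)) = 0 \<and> L2_inner g (circle_exp (-2)) = 0" if "g \<in> orbit (circle_exp 0)" for g
    using that
  proof induction
    case base
    then show ?case by (simp only: L2_inner_circle_exp) simp
  next
    case (step g i)
    then show ?case
      using orbit_L2[OF step.hyps(1)] by (simp add: L2_inner_loop_rep_exp_m1 L2_inner_loop_rep_exp_m2)
  qed
  then show ?thesis
    by (intro reducible_if_coinvariant_vector[of "circle_exp 0" "\<lambda>i. cnj (C i 0)" "circle_exp (-1)"] eig)
       (auto simp: L2_inner_circle_exp)
qed

lemma reducible_b:
  assumes "Q $$ (N - 1, N - 1) = 0" "Q $$ (N - 2, N - 2) = 1"
  shows "reducible_rep N T"
proof -
  have "Q $$ (k, N - 1) = 0" if "k < N" for k
    using Q_column_zero[OF _ assms(1) that] N_gt by linarith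
  then have "D i (N - 1) = 0" for i
    unfolding D_def by (intro sum.neutral) simp
  then have eig: "L2_inner (T i f) (circle_exp (-1)) = cnj (C i (N - 1)) * L2_inner f (circle_exp (-1))"
    if "i < N" "f \<in> L2" for i f
    using L2_inner_loop_rep_exp_m1[OF that(2,1)] by simp
  \<comment> \<open>Now the adjoints send the vector of index -2 to multiples of itself, so index -2
    alone can be followed along the orbit.\<close>
  have C0: "C i (N - 2) = 0" for i
    unfolding C_def
  proof (intro sum.neutral ballI)
    fix k assume "k \<in> {..<N}"
    then have "E k (N - 2) = 0" using N_gt assms by (intro E_column_zero) auto
    then show "V $$ (i, k) * E k (N - 2) = 0" by (simp only: mult_zero_right)
  qed
  have "L2_inner g (circle_exp (-2)) = 0" if "g \<in> orbit (circle_exp (-1))" for g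
    using that
  proof induction
    case base
    then show ?case by (simp only: L2_inner_circle_exp) simp
  next
    case (step g i)
    then show ?case
      using orbit_L2[OF step.hyps(1)] by (simp add: L2_inner_loop_rep_exp_m2 C0)
  qed
  then show ?thesis
    by (intro reducible_if_coinvariant_vector[of "circle_exp (-1)" "\<lambda>i. cnj (C i (N - 1))" "circle_exp (-2)"] eig)
       (auto simp: L2_inner_circle_exp)
qed

text \<open>The index map \<open>k \<mapsto> {k div N, k div N - 1}\<close> contracts towards \<open>{-2, -1, 0}\<close>, so a kernel satisfying the
  recursion is determined by its values there.\<close>

lemma kernel_scalar:
  fixes X :: "int \<Rightarrow> int \<Rightarrow> complex"
  assumes herm: "\<And>k l. X l k = cnj (X k l)"
    and rec: "\<And>j j' m m'. j < N \<Longrightarrow> j' < N \<Longrightarrow> X (int j + int N * m) (int j' + int N * m') =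
      E j' j * X m m' + Q $$ (j', j) * X (m - 1) (m' - 1)"
    and a: "Q $$ (0, 0) \<noteq> 0"
    and b: "\<not> (Q $$ (N - 1, N - 1) = 0 \<and> Q $$ (N - 2, N - 2) = 1)"
  shows "X k l = (if k = l then X 0 0 else 0)"
proof -
  have N1: "int (N - 1) + int N * (-1) = -1" and N2: "int (N - 2) + int N * (-1) = -2"
    using N_gt by (simp_all add: of_nat_diff)
  have lt: "0 < N" "N - 1 < N" "N - 2 < N" "N - 1 \<noteq> 0" "N - 2 \<noteq> 0" "N - 1 \<noteq> N - 2"
    using N_gt by auto
  \<comment> \<open>The recursion at pairs from {0, -1, -2}, where it refers only to such pairs; the
    remaining pairs follow by hermitian symmetry.\<close>
  have r00: "X 0 0 = (1 - Q $$ (0, 0)) * X 0 0 + Q $$ (0, 0) * X (-1) (-1)"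
    using rec[OF lt(1) lt(1), of 0 0] by simp
  have r11: "X (-1) (-1) = (1 - Q $$ (N - 1, N - 1)) * X (-1) (-1) + Q $$ (N - 1, N - 1) * X (-2) (-2)"
    using rec[OF lt(2) lt(2), of "-1" "-1"] unfolding N1 by simp
  have r22: "X (-2) (-2) = (1 - Q $$ (N - 2, N - 2)) * X (-1) (-1) + Q $$ (N - 2, N - 2) * X (-2) (-2)"
    using rec[OF lt(3) lt(3), of "-1" "-1"] unfolding N2 by simp
  have r12: "X (-1) (-2) = - Q $$ (N - 2, N - 1) * X (-1) (-1) + Q $$ (N - 2, N - 1) * X (-2) (-2)"
    using rec[OF lt(2) lt(3), of "-1" "-1"] lt(6) unfolding N1 N2 by auto
  have r01: "X 0 (-1) = - Q $$ (N - 1, 0) * X 0 (-1) + Q $$ (N - 1, 0) * X (-1) (-2)"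
    using rec[OF lt(1) lt(2), of 0 "-1"] lt(4) unfolding N1 by auto
  have r02: "X 0 (-2) = - Q $$ (N - 2, 0) * X 0 (-1) + Q $$ (N - 2, 0) * X (-1) (-2)"
    using rec[OF lt(1) lt(3), of 0 "-1"] lt(5) unfolding N2 by auto
  have "Q $$ (0, 0) * (X (-1) (-1) - X 0 0) = 0"
    using r00 by (auto simp: algebra_simps)
  then have x1: "X (-1) (-1) = X 0 0" using a by simp
  have "Q $$ (N - 1, N - 1) * (X (-2) (-2) - X (-1) (-1)) = 0"
    using r11 by (auto simp: algebra_simps)
  \<comment> \<open>The failure of (b) means that one of the two factors 1 - Q (N - 2) (N - 2) and Q
    (N - 1) (N - 1) is nonzero.\<close>
  moreover have "(1 - Q $$ (N - 2, N - 2)) * (X (-2) (-2) - X (-1) (-1)) = 0"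
    using r22 by (auto simp: algebra_simps)
  ultimately have x2: "X (-2) (-2) = X 0 0" using b x1 by auto
  have x12: "X (-1) (-2) = 0" using r12 x1 x2 by simp
  have "1 + Q $$ (N - 1, 0) \<noteq> 0"
  proof
    assume "1 + Q $$ (N - 1, 0) = 0"
    then have "Q $$ (N - 1, 0) = -1" by (simp add: eq_neg_iff_add_eq_0 add.commute)
    then have one: "cmod (Q $$ (N - 1, 0)) = 1" by simp
    \<comment> \<open>The squared norm s of column 0 equals the entry Q 0 0. That entry alone
      contributes s^2 to s, and an entry -1 would contribute a further 1, but s^2 + 1 <= s has no
      real solution.\<close>
    define s where "s = (\<Sum>k<N. (cmod (Q $$ (k, 0)))\<^sup>2)"
    have Q0: "Q $$ (0, 0) = of_real s" using Q_diag_column[OF lt(1)] by (simp only: s_def)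
    have "(\<Sum>k\<in>{0, N - 1}. (cmod (Q $$ (k, 0)))\<^sup>2) \<le> s"
      unfolding s_def by (rule sum_mono2) (use lt in auto)
    then have "s\<^sup>2 + 1 \<le> s" using one lt(4) by (simp add: Q0)
    moreover have "2 * s * 1 \<le> s\<^sup>2 + 1\<^sup>2" by (rule sum_squares_bound)
    ultimately show False using zero_le_power2[of s] by simp
  qed
  moreover have "(1 + Q $$ (N - 1, 0)) * X 0 (-1) = 0"
    using r01 x12 by (simp add: algebra_simps eq_neg_iff_add_eq_0)
  ultimately have x01: "X 0 (-1) = 0" by simp
  have x02: "X 0 (-2) = 0" using r02 x12 x01 by simp
  have base: "X k l = (if k = l then X 0 0 else 0)" if "\<bar>k + 1\<bar> \<le> 1" "\<bar>l + 1\<bar> \<le> 1" for k l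
  proof -
    have "k \<in> {0, -1, -2}" "l \<in> {0, -1, -2}" using that by auto
    then show ?thesis
      using x1 x2 x12 x01 x02 herm[of "-1" 0] herm[of "-2" 0] herm[of "-2" "-1"] by auto
  qed
  \<comment> \<open>Induction on the distance from the centre -1 of {-2, -1, 0}; n = 0 is the
    critical set itself.\<close>
  have "X k l = (if k = l then X 0 0 else 0)" if "\<bar>k + 1\<bar> \<le> int n + 1" "\<bar>l + 1\<bar> \<le> int n + 1" for n k l
    using that
  proof (induction n arbitrary: k l)
    case 0
    then show ?case by (intro base) auto
  next
    case (Suc n)
    \<comment> \<open>The two bounds concern the distances of m and m - 1 from -1. They use N >= 3:
      for N = 2 and n = 0 the index k = -3 has m = -2, which breaks the second one.\<close>
    have contract: "\<bar>k div int N + 1\<bar> \<le> int n + 1 \<and> \<bar>k div int N\<bar> \<le> int n + 1" if k: "\<bar>k + 1\<bar> \<le> int (Suc n) + 1" for k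
    proof -
      define m r p where "m = k div int N" and "r = k mod int N" and "p = int N * m"
      have kmod: "k = p + r" "0 \<le> r" "r < int N"
        using N_gt by (simp_all add: m_def r_def p_def)
      have N3: "int N \<ge> 3" using N_gt by simp
      have k': "k + 1 \<le> int n + 2" "- (int n + 2) \<le> k + 1" "0 \<le> int n" using k by auto
      have "m \<le> int n"
      proof (rule ccontr)
        assume "\<not> m \<le> int n"
        then have "p \<ge> 3 * (int n + 1)" unfolding p_def using N3 by (intro mult_mono) auto
        with kmod k' show False by presburger
      qed
      moreover have "m \<ge> - int n - 1"
      proof (rule ccontr)
        assume "\<not> m \<ge> - int n - 1"
        then have "int N * (- m - 1) \<ge> 3 * (int n + 1)" using N3 by (intro mult_mono) auto
        then have "p + int N \<le> - 3 * (int n + 1)" by (simp add: p_def algebra_simps)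
        with kmod k' show False by presburger
      qed
      ultimately show ?thesis unfolding m_def[symmetric] by linarith
    qed
    define j where "j = nat (k mod int N)"
    define j' where "j' = nat (l mod int N)"
    define m where "m = k div int N"
    define m' where "m' = l div int N"
    have jj: "j < N" "j' < N" using N_gt by (simp_all add: j_def j'_def nat_less_iff)
    have k: "k = int j + int N * m" and l: "l = int j' + int N * m'"
      using N_gt by (simp_all add: j_def j'_def m_def m'_def)
    have "X k l = E j' j * X m m' + Q $$ (j', j) * X (m - 1) (m' - 1)"
      unfolding k l by (rule rec[OF jj])
    also have "X m m' = (if m = m' then X 0 0 else 0)"
      by (rule Suc.IH) (use contract[OF Suc.prems(1)] contract[OF Suc.prems(2)] in \<open>auto simp: m_def m'_def\<close>)
    also have "X (m - 1) (m' - 1) = (if m - 1 = m' - 1 then X 0 0 else 0)"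
      by (rule Suc.IH) (use contract[OF Suc.prems(1)] contract[OF Suc.prems(2)] in \<open>auto simp: m_def m'_def\<close>)
    \<comment> \<open>Both values of X are now the same scalar multiple of a Kronecker delta, and
      the entries of 1 - Q and Q add up to the identity.\<close>
    finally have X: "X k l = (if m = m' \<and> j = j' then X 0 0 else 0)"
      by (auto simp: algebra_simps)
    have "k = l \<longleftrightarrow> m = m' \<and> j = j'"
    proof
      show "m = m' \<and> j = j'" if "k = l" using that by (simp add: j_def j'_def m_def m'_def)
      show "k = l" if "m = m' \<and> j = j'" unfolding k l using that by simp
    qed
    with X show ?case by simp
  qed
  from this[of k "nat (\<bar>k + 1\<bar> + \<bar>l + 1\<bar>)" l] show ?thesis by simp
qed

lemma irreducible:
  assumes a: "Q $$ (0, 0) \<noteq> 0"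
    and b: "\<not> (Q $$ (N - 1, N - 1) = 0 \<and> Q $$ (N - 2, N - 2) = 1)"
  shows "irreducible_rep N T"
  unfolding irreducible_rep_def
proof (intro allI impI)
  fix M assume "closed_subspace M \<and> (\<forall>i<N. \<forall>\<xi>\<in>M. T i \<xi> \<in> M \<and> L2_adjoint (T i) \<xi> \<in> M)"
  then have M: "closed_subspace M"
    and TM: "\<And>i \<xi>. i < N \<Longrightarrow> \<xi> \<in> M \<Longrightarrow> T i \<xi> \<in> M"
    and SM: "\<And>i \<xi>. i < N \<Longrightarrow> \<xi> \<in> M \<Longrightarrow> L2_adjoint (T i) \<xi> \<in> M"
    by auto
  have M_L2: "f \<in> L2" if "f \<in> M" for f using M that by (rule closed_subspace_L2)
  have "\<exists>p. p \<in> M \<and> (\<forall>g\<in>M. L2_inner g (\<lambda>z. circle_exp k z - p z) = 0)" for k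
    using closed_subspace_projection[OF M circle_exp_L2[of k]] by metis
  then obtain P where PM: "\<And>k. P k \<in> M"
    and orth: "\<And>k g. g \<in> M \<Longrightarrow> L2_inner g (\<lambda>z. circle_exp k z - P k z) = 0"
    by metis
  have PL: "P k \<in> L2" for k using PM M_L2 by blast
  have proj: "L2_inner g (circle_exp k) = L2_inner g (P k)" if "g \<in> M" for g k
    using orth[OF that, of k] by (simp add: L2_inner_diff_right M_L2[OF that] PL)
  \<comment> \<open>The matrix of the projection, built from representatives of the projected basis
    vectors.\<close>
  define X where "X k l = L2_inner (P k) (P l)" for k l
  have herm: "X l k = cnj (X k l)" for k l
    unfolding X_def by (rule L2_inner_commute)
  have Xe: "L2_inner (P k) (circle_exp l) = X k l" for k l
    unfolding X_def by (rule proj[OF PM])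
  \<comment> \<open>The projection commutes with \<open>T i\<close> and its adjoint: it is moved
    from one argument to the other, by invariance under the adjoint (\<open>SM\<close>) for index n
    and under \<open>T i\<close> (\<open>TM\<close>) for index k.\<close>
  have XT: "L2_inner (P (int j + int N * m)) (T i (circle_exp n)) = C i j * X m n + D i j * X (m - 1) n"
    if i: "i < N" and j: "j < N" for i j m n
  proof -
    define k where "k = int j + int N * m"
    have "L2_inner (P k) (T i (circle_exp n)) = cnj (L2_inner (circle_exp n) (L2_adjoint (T i) (P k)))"
      by (subst L2_inner_commute) (simp add: L2_inner_adjoint[OF i PL])
    also have "\<dots> = L2_inner (L2_adjoint (T i) (P k)) (circle_exp n)"
      by (rule L2_inner_commute[symmetric])
    also have "\<dots> = L2_inner (L2_adjoint (T i) (P k)) (P n)"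
      by (rule proj[OF SM[OF i PM]])
    also have "\<dots> = cnj (L2_inner (P n) (L2_adjoint (T i) (P k)))"
      by (rule L2_inner_commute)
    also have "\<dots> = cnj (L2_inner (T i (P n)) (P k))"
      by (simp add: L2_inner_adjoint[OF i PL] PL)
    also have "\<dots> = cnj (L2_inner (T i (P n)) (circle_exp k))"
      by (simp add: proj[OF TM[OF i PM]])
    also have "\<dots> = C i j * X m n + D i j * X (m - 1) n"
      unfolding k_def L2_inner_loop_rep_circle_exp[OF PL i j] Xe by (simp add: herm[symmetric])
    finally show ?thesis by (simp add: k_def)
  qed
  have rec: "X (int j + int N * m) (int j' + int N * m') = E j' j * X m m' + Q $$ (j', j) * X (m - 1) (m' - 1)"
    if j: "j < N" "j' < N" for j j' m m'
  proof -
    have "X (int j + int N * m) (int j' + int N * m') =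
        (\<Sum>i<N. cnj (C i j') * (C i j * X m m' + D i j * X (m - 1) m') +
          cnj (D i j') * (C i j * X m (m' - 1) + D i j * X (m - 1) (m' - 1)))"
      unfolding Xe[symmetric] L2_inner_circle_exp_right[OF PL j(2)]
      by (intro sum.cong refl) (simp add: XT j Xe)
    also have "\<dots> = (\<Sum>i<N. cnj (C i j') * C i j) * X m m' + (\<Sum>i<N. cnj (C i j') * D i j) * X (m - 1) m' +
        (\<Sum>i<N. cnj (D i j') * C i j) * X m (m' - 1) + (\<Sum>i<N. cnj (D i j') * D i j) * X (m - 1) (m' - 1)"
      unfolding sum_distrib_right sum.distrib[symmetric] by (intro sum.cong refl) (simp add: algebra_simps)
    also have "\<dots> = E j' j * X m m' + Q $$ (j', j) * X (m - 1) (m' - 1)"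
      by (simp only: sum_CC sum_CD sum_DC sum_DD j) simp
    finally show ?thesis .
  qed
  have scalar: "X k l = (if k = l then X 0 0 else 0)" for k l
    by (rule kernel_scalar[OF herm rec a b])
  have AE0: "AE z in circle_measure. f z = 0" if f: "f \<in> L2" "\<And>k. L2_inner f (circle_exp k) = 0" for f
  proof (rule L2_fourier_AE_zero[OF f(1)])
    show "L2_inner (circle_exp k) f = 0" for k
      by (subst L2_inner_commute) (simp add: f(2))
  qed
  show "M = L2_null \<or> M = L2"
  proof (cases "X 0 0 = 0")
    case True
    have "f \<in> L2_null" if f: "f \<in> M" for f
    proof -
      have "L2_inner f (circle_exp k) = 0" for k
      proof -
        \<comment> \<open>The diagonal entry is the squared norm of \<open>P k\<close>, so every
          projected basis vector is null.\<close>
        have "X k k = 0" using scalar[of k k] True by simp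
        then have "L2_norm (P k) = 0" by (simp add: X_def L2_inner_self)
        then have "cmod (L2_inner f (P k)) \<le> 0"
          using L2_Cauchy_Schwarz[OF M_L2[OF f] PL[of k]] by simp
        then show ?thesis by (simp add: proj[OF f])
      qed
      then show ?thesis using AE0[OF M_L2[OF f]] M_L2[OF f] by (simp add: L2_null_def)
    qed
    moreover have "f \<in> M" if f: "f \<in> L2_null" for f
    proof (rule closed_subspace_AE_cong[OF M closed_subspace_zero[OF M]])
      have "AE z in circle_measure. f z = 0" using f by (simp add: L2_null_def)
      then show "AE z in circle_measure. 0 = f z" by eventually_elim simp
      show "f \<in> L2" using f by (simp add: L2_null_def)
    qed
    ultimately show ?thesis by blast
  next
    case False
    define c where "c = X 0 0"
    \<comment> \<open>The Fourier coefficients of \<open>P k\<close> are the entries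
      \<open>X k l\<close>, so \<open>P k\<close> is c times the basis vector almost everywhere, and
      dividing by c puts that vector into M.\<close>
    have eM: "circle_exp k \<in> M" for k
    proof (rule closed_subspace_AE_cong[OF M closed_subspace_cmult[OF M PM[of k], of "1 / c"]])
      have L: "(\<lambda>z. P k z - c * circle_exp k z) \<in> L2"
        by (rule L2_diff[OF PL L2_cmult[OF circle_exp_L2]])
      \<comment> \<open>The inner product is conjugate linear in its first argument, so c enters
        conjugated.\<close>
      have "cnj c = c" unfolding c_def by (rule herm[symmetric])
      then have "L2_inner (\<lambda>z. P k z - c * circle_exp k z) (circle_exp l) = 0" for l
        using scalar[of k l]
        by (simp add: L2_inner_diff_left PL L2_cmult L2_inner_cmult_left Xe L2_inner_circle_exp c_def)
      from AE0[OF L this] show "AE z in circle_measure. 1 / c * P k z = circle_exp k z"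
        by eventually_elim (use False in \<open>simp add: c_def\<close>)
    qed simp
    have "f \<in> M" if f: "f \<in> L2" for f
    proof -
      obtain p where p: "p \<in> M" and po: "\<And>g. g \<in> M \<Longrightarrow> L2_inner g (\<lambda>z. f z - p z) = 0"
        using closed_subspace_projection[OF M f] by metis
      \<comment> \<open>The residual is orthogonal to M, hence to all basis vectors.\<close>
      have "AE z in circle_measure. f z - p z = 0"
        by (rule L2_fourier_AE_zero) (use f M_L2[OF p] po eM in auto)
      then have "AE z in circle_measure. p z = f z" by eventually_elim simp
      then show ?thesis by (rule closed_subspace_AE_cong[OF M p f])
    qed
    then show ?thesis using M_L2 by blast
  qed
qed

end

theorem theorem5p7:
  fixes N :: nat and V Q :: "complex mat" and A :: "complex \<Rightarrow> complex mat"
  assumes "N > 2"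
    and "V \<in> unitary_group N"
    and "Q \<in> orthogonal_projections N"
    and "A = (\<lambda>z. V * (1\<^sub>m N - Q + z \<cdot>\<^sub>m Q))"
  shows "(reducible_rep N (loop_rep N A) \<longleftrightarrow>
            Q $$ (0, 0) = 0 \<or>
            (Q $$ (N - 1, N - 1) = 0 \<and> Q $$ (N - 2, N - 2) = 1)) \<and>
         (\<not> (Q $$ (0, 0) = 0) \<and>
          \<not> (Q $$ (N - 1, N - 1) = 0 \<and> Q $$ (N - 2, N - 2) = 1) \<longrightarrow>
            irreducible_rep N (loop_rep N A))"
proof -
  interpret genus_two_loop N V Q A
    by unfold_locales (use assms in auto)
  show ?thesis
    using reducible_a reducible_b irreducible unfolding reducible_rep_def by blast
qed

end
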